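(* Let $n\ge 1$ and let $\mathbf a=(a_0,\dots,a_n)$ be a tuple of positive integers. Let $\mathcal I_{\mathbf a}\subset\mathbb C[x_0,\dots,x_n,Y_0,\dots,Y_n]$ be the ideal generated by $\sum_{j=0}^n x_j^{a_j}Y_j$. Let $\mathcal I_{\mathbf a}^\vee\subset\mathbb C[x_i,Z_{jk}\mid 0\le i\le n,\ 0\le j<k\le n]$ be the ideal generated by the polynomials $x_j^{a_j}Z_{ik}-x_k^{a_k}Z_{ij}-x_i^{a_i}Z_{jk}$ for $0\le i<j<k\le n$ together with the quadratic Plücker relations $Z_{ij}Z_{kl}-Z_{ik}Z_{jl}+Z_{il}Z_{jk}$ for $0\le i<j<k<l\le n$. Then the ideals $\mathcal I_{\mathbf a}$ and $\mathcal I_{\mathbf a}^\vee$ are well-poised.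
   Context: For an ideal $I$ in a polynomial ring over $\mathbb C$ in $N$ variables and a weight $w\in\mathbb Q^N$, $\mathrm{in}_w(I)$ is the ideal generated by the initial forms $\mathrm{in}_w(f)$, $f\in I$, where $\mathrm{in}_w(f)$ is the sum of the terms of $f$ of minimal $w$-weight. The tropical variety $\mathrm{Trop}(I)$ is the set of $w\in\mathbb Q^N$ such that $\mathrm{in}_w(I)$ contains no monomial. The ideal $I$ is well-poised if $\mathrm{in}_w(I)$ is a prime ideal for every $w\in\mathrm{Trop}(I)$. *)

theory Defs
  imports Complex_Main "HOL-Library.Poly_Mapping" "HOL-Library.FuncSet" "HOL-Algebra.Ideal"
begin

section \<open>Polynomial rings over the complex numbers\<close>

text \<open>An exponent vector is a finitely supported function from variables to \<open>nat\<close>, and a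
  polynomial is a finitely supported function from exponent vectors to coefficients; the
  product on \<open>poly_mapping\<close> is convolution.  The type \<open>'v\<close> may contain more symbols than the
  variables of interest, so the ring itself is cut out by a set \<open>V\<close> of variables.\<close>

type_synonym 'v expo = "'v \<Rightarrow>\<^sub>0 nat"
type_synonym 'v cpoly = "'v expo \<Rightarrow>\<^sub>0 complex"

definition monomial :: "'v expo \<Rightarrow> 'v cpoly"
  where "monomial m = Poly_Mapping.single m 1"

definition var :: "'v \<Rightarrow> 'v cpoly"
  where "var v = monomial (Poly_Mapping.single v 1)"

definition polys_in :: "'v set \<Rightarrow> 'v cpoly set"
  where "polys_in V = {f. \<forall>m\<in>Poly_Mapping.keys f. Poly_Mapping.keys m \<subseteq> V}"

definition poly_ring :: "'v set \<Rightarrow> 'v cpoly ring"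
  where "poly_ring V = \<lparr>carrier = polys_in V, mult = (*), one = 1, zero = 0, add = (+)\<rparr>"

lemma polys_in_0: "0 \<in> polys_in V"
  by (simp add: polys_in_def)

lemma polys_in_1: "1 \<in> polys_in V"
  by (simp add: polys_in_def)

lemma polys_in_add: "f \<in> polys_in V \<Longrightarrow> g \<in> polys_in V \<Longrightarrow> f + g \<in> polys_in V"
  unfolding polys_in_def using Poly_Mapping.keys_add[of f g] by blast

lemma polys_in_uminus: "f \<in> polys_in V \<Longrightarrow> - f \<in> polys_in V"
  by (simp add: polys_in_def in_keys_iff)

lemma polys_in_diff: "f \<in> polys_in V \<Longrightarrow> g \<in> polys_in V \<Longrightarrow> f - g \<in> polys_in V"
  using polys_in_add[of f V "- g"] polys_in_uminus[of g V] by simp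

lemma polys_in_mult:
  assumes "f \<in> polys_in V" "g \<in> polys_in V"
  shows "f * g \<in> polys_in V"
  unfolding polys_in_def
proof (rule CollectI, rule ballI)
  fix m assume "m \<in> Poly_Mapping.keys (f * g)"
  then obtain a b where "a \<in> Poly_Mapping.keys f" "b \<in> Poly_Mapping.keys g" "m = a + b"
    using Poly_Mapping.keys_mult[of f g] by blast
  then show "Poly_Mapping.keys m \<subseteq> V"
    using assms Poly_Mapping.keys_add[of a b] unfolding polys_in_def by blast
qed

lemma polys_in_power: "f \<in> polys_in V \<Longrightarrow> f ^ k \<in> polys_in V"
  by (induction k) (simp_all add: polys_in_1 polys_in_mult)

lemma polys_in_sum: "(\<And>i. i \<in> A \<Longrightarrow> f i \<in> polys_in V) \<Longrightarrow> sum f A \<in> polys_in V"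
  by (induction A rule: infinite_finite_induct) (simp_all add: polys_in_0 polys_in_add)

lemma polys_in_var: "v \<in> V \<Longrightarrow> var v \<in> polys_in V"
  by (simp add: polys_in_def var_def monomial_def)

lemma cring_poly_ring: "cring (poly_ring V)"
proof (rule cringI)
  show "abelian_group (poly_ring V)"
  proof (rule abelian_groupI)
    fix f assume f: "f \<in> carrier (poly_ring V)"
    show "\<exists>g\<in>carrier (poly_ring V). g \<oplus>\<^bsub>poly_ring V\<^esub> f = \<zero>\<^bsub>poly_ring V\<^esub>"
      by (rule bexI[of _ "- f"]) (use f in \<open>simp_all add: poly_ring_def polys_in_uminus\<close>)
  qed (simp_all add: poly_ring_def polys_in_0 polys_in_add algebra_simps)
  show "comm_monoid (poly_ring V)"
    by (rule comm_monoidI) (simp_all add: poly_ring_def polys_in_1 polys_in_mult algebra_simps)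
qed (simp add: poly_ring_def algebra_simps)


section \<open>Initial ideals, tropical varieties and well-poised ideals\<close>

definition weight :: "('v \<Rightarrow> rat) \<Rightarrow> 'v expo \<Rightarrow> rat"
  where "weight w m = (\<Sum>v\<in>Poly_Mapping.keys m. w v * of_nat (Poly_Mapping.lookup m v))"

text \<open>For \<open>f = 0\<close> the sum is empty, so \<open>initial_form w 0 = 0\<close>.\<close>

definition initial_form :: "('v \<Rightarrow> rat) \<Rightarrow> 'v cpoly \<Rightarrow> 'v cpoly"
  where "initial_form w f =
    (\<Sum>m | m \<in> Poly_Mapping.keys f \<and> weight w m = Min (weight w ` Poly_Mapping.keys f).
       Poly_Mapping.single m (Poly_Mapping.lookup f m))"

definition initial_ideal :: "'v set \<Rightarrow> ('v \<Rightarrow> rat) \<Rightarrow> 'v cpoly set \<Rightarrow> 'v cpoly set"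
  where "initial_ideal V w I = Idl\<^bsub>poly_ring V\<^esub> (initial_form w ` I)"

text \<open>Weights are the points of \<open>\<rat>\<^sup>V\<close>, represented as functions that are \<open>undefined\<close> off \<open>V\<close>.
  The constant \<open>1\<close> counts as a monomial.\<close>

definition trop :: "'v set \<Rightarrow> 'v cpoly set \<Rightarrow> ('v \<Rightarrow> rat) set"
  where "trop V I = {w \<in> V \<rightarrow>\<^sub>E UNIV. \<forall>m. Poly_Mapping.keys m \<subseteq> V \<longrightarrow> monomial m \<notin> initial_ideal V w I}"

definition well_poised :: "'v set \<Rightarrow> 'v cpoly set \<Rightarrow> bool"
  where "well_poised V I \<longleftrightarrow>
    ideal I (poly_ring V) \<and> (\<forall>w\<in>trop V I. primeideal (initial_ideal V w I) (poly_ring V))"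


section \<open>The two families of ideals\<close>

datatype vars = Xv nat | Yv nat | Zv nat nat

abbreviation xv :: "nat \<Rightarrow> vars cpoly" where "xv i \<equiv> var (Xv i)"
abbreviation yv :: "nat \<Rightarrow> vars cpoly" where "yv i \<equiv> var (Yv i)"
abbreviation zv :: "nat \<Rightarrow> nat \<Rightarrow> vars cpoly" where "zv i j \<equiv> var (Zv i j)"

definition XY_vars :: "nat \<Rightarrow> vars set"
  where "XY_vars n = {Xv i | i. i \<le> n} \<union> {Yv i | i. i \<le> n}"

definition XZ_vars :: "nat \<Rightarrow> vars set"
  where "XZ_vars n = {Xv i | i. i \<le> n} \<union> {Zv j k | j k. j < k \<and> k \<le> n}"

definition I_ideal :: "nat \<Rightarrow> (nat \<Rightarrow> nat) \<Rightarrow> vars cpoly set"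
  where "I_ideal n a = Idl\<^bsub>poly_ring (XY_vars n)\<^esub> {\<Sum>j=0..n. xv j ^ a j * yv j}"

definition dual_gens :: "nat \<Rightarrow> (nat \<Rightarrow> nat) \<Rightarrow> vars cpoly set"
  where "dual_gens n a =
    {xv j ^ a j * zv i k - xv k ^ a k * zv i j - xv i ^ a i * zv j k | i j k. i < j \<and> j < k \<and> k \<le> n} \<union>
    {zv i j * zv k l - zv i k * zv j l + zv i l * zv j k | i j k l. i < j \<and> j < k \<and> k < l \<and> l \<le> n}"

definition I_dual_ideal :: "nat \<Rightarrow> (nat \<Rightarrow> nat) \<Rightarrow> vars cpoly set"
  where "I_dual_ideal n a = Idl\<^bsub>poly_ring (XZ_vars n)\<^esub> (dual_gens n a)"

lemma gen_in_carrier: "(\<Sum>j=0..n. xv j ^ a j * yv j) \<in> carrier (poly_ring (XY_vars n))"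
  by (auto simp: poly_ring_def XY_vars_def
      intro!: polys_in_sum polys_in_mult polys_in_power polys_in_var)

lemma dual_gens_in_carrier: "dual_gens n a \<subseteq> carrier (poly_ring (XZ_vars n))"
  by (auto simp: dual_gens_def poly_ring_def XZ_vars_def
      intro!: polys_in_add polys_in_diff polys_in_mult polys_in_power polys_in_var)

end

theory Submission
  imports Defs "HOL-Library.Countable" "HOL-Library.Product_Lexorder"
begin

text \<open>
  Both families are treated by one criterion, \<open>initial_ideal_primeI\<close>.  Let \<open>I\<close> be generated by
  \<open>G\<close> and let \<open>w\<close> be a weight.  Suppose a substitution \<open>\<sigma>\<close> of polynomials for the variables kills
  \<open>G\<close>, and the target variables carry weights for which the lowest weight occurring in \<open>\<sigma> v\<close> is
  \<open>w v\<close>.  Let \<open>\<sigma>\<^sub>w v\<close> be the lowest component of \<open>\<sigma> v\<close>.  If \<open>f\<close> is in \<open>I\<close>, then the lowest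
  component of \<open>subst \<sigma> f = 0\<close> is the image of \<open>in\<^sub>w f\<close> under \<open>\<sigma>\<^sub>w\<close>, so \<open>in\<^sub>w I\<close> lies in the
  kernel of \<open>\<sigma>\<^sub>w\<close>, which is prime because polynomial rings are domains.  For equality it suffices
  to have a set \<open>S\<close> of monomials that spans modulo \<open>in\<^sub>w I\<close> (a rewriting argument with the
  initial forms of \<open>G\<close>) and is linearly independent under \<open>\<sigma>\<^sub>w\<close> (a second degeneration turns
  \<open>\<sigma>\<^sub>w\<close> into a monomial substitution that is injective on \<open>S\<close>).

  For the hypersurface, a tropical weight makes two terms \<open>j\<^sub>0\<close>, \<open>j\<^sub>1\<close> of the equation minimal.
  Put \<open>Y\<^sub>j = x\<^sub>j\<^sub>0\<^bsup>a\<^esup> T\<^sub>j\<close> for \<open>j \<noteq> j\<^sub>0\<close> and solve for \<open>Y\<^sub>j\<^sub>0\<close>; the set \<open>S\<close> consists of the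
  monomials that are not divisible by the \<open>j\<^sub>0\<close>-th term.

  For the dual ideal, think of \<open>x\<^sub>i\<^bsup>a\<^esup>\<close> as a Pluecker coordinate with one additional index.  The
  relations hold for \<open>Z\<^sub>i\<^sub>j = x\<^sub>i\<^bsup>a\<^esup> x\<^sub>j\<^bsup>a\<^esup> (r\<^sub>j - r\<^sub>i)\<close>.  At a tropical weight \<open>w\<close> the numbers
  \<open>d i j = w(Z\<^sub>i\<^sub>j) - a\<^sub>i w(x\<^sub>i) - a\<^sub>j w(x\<^sub>j)\<close> form an ultrametric (the smallest of \<open>d i j\<close>,
  \<open>d j k\<close>, \<open>d i k\<close> is attained twice).  Its tree can be drawn in the plane
  (\<open>ultrametric_planar_order\<close>), that is, the indices can be ordered such that \<open>d i j\<close> is the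
  minimum of heights \<open>h k\<close> over the gaps \<open>k\<close> between \<open>i\<close> and \<open>j\<close>
  (\<open>planar_ultrametric_heights\<close>).  Writing \<open>r\<^sub>j - r\<^sub>i\<close> as the sum of variables \<open>s\<^sub>k\<close> of weight \<open>h k\<close>
  over these gaps makes \<open>\<sigma> Z\<^sub>i\<^sub>j\<close> have lowest weight \<open>w(Z\<^sub>i\<^sub>j)\<close>.  The set \<open>S\<close> consists of the
  noncrossing monomials.  In each Pluecker relation the crossing term has minimal weight, by
  planarity, and it can be rewritten.  The second degeneration keeps, in \<open>\<sigma> Z\<^sub>i\<^sub>j\<close>, the first gap of
  minimal height; \<open>determined_chord\<close> shows that a noncrossing monomial can be recovered from its
  image chord by chord.
\<close>

abbreviation keys :: "('a \<Rightarrow>\<^sub>0 'b::zero) \<Rightarrow> 'a set" where "keys \<equiv> Poly_Mapping.keys"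
abbreviation lookup :: "('a \<Rightarrow>\<^sub>0 'b::zero) \<Rightarrow> 'a \<Rightarrow> 'b" where "lookup \<equiv> Poly_Mapping.lookup"
abbreviation single :: "'a \<Rightarrow> 'b \<Rightarrow> 'a \<Rightarrow>\<^sub>0 'b::zero" where "single \<equiv> Poly_Mapping.single"

section \<open>Weights and weight components\<close>

lemma weight_superset:
  assumes "finite A" "keys m \<subseteq> A"
  shows "weight w m = (\<Sum>v\<in>A. w v * of_nat (lookup m v))"
  unfolding weight_def
  by (rule sum.mono_neutral_left) (use assms in \<open>auto simp: in_keys_iff\<close>)

lemma weight_0 [simp]: "weight w 0 = 0"
  by (simp add: weight_def)

lemma weight_single [simp]: "weight w (single v k) = w v * of_nat k"
  by (cases "k = 0") (simp_all add: weight_def)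

lemma weight_add [simp]: "weight w (m + m') = weight w m + weight w m'"
proof -
  let ?A = "keys m \<union> keys m'"
  have "weight w (m + m') = (\<Sum>v\<in>?A. w v * of_nat (lookup (m + m') v))"
    by (rule weight_superset) (use Poly_Mapping.keys_add[of m m'] in auto)
  also have "\<dots> = (\<Sum>v\<in>?A. w v * of_nat (lookup m v)) + (\<Sum>v\<in>?A. w v * of_nat (lookup m' v))"
    by (simp add: lookup_add algebra_simps sum.distrib)
  also have "\<dots> = weight w m + weight w m'"
    by (subst (1 2) weight_superset[where A = ?A]) auto
  finally show ?thesis .
qed

lemma weight_of_nat:
  "weight (\<lambda>v. of_nat (\<mu> v)) m = of_nat (\<Sum>v\<in>keys m. \<mu> v * lookup m v)"
  by (simp add: weight_def)

text \<open>The component of weight \<open>c\<close> of a polynomial.\<close>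

definition wcomp :: "('v \<Rightarrow> rat) \<Rightarrow> rat \<Rightarrow> 'v cpoly \<Rightarrow> 'v cpoly"
  where "wcomp w c f = Poly_Mapping.mapp (\<lambda>m a. a when weight w m = c) f"

lemma lookup_wcomp: "lookup (wcomp w c f) m = (lookup f m when weight w m = c)"
  by (auto simp: wcomp_def lookup_mapp when_def in_keys_iff)

lemma keys_wcomp: "keys (wcomp w c f) = {m \<in> keys f. weight w m = c}"
  by (auto simp: in_keys_iff lookup_wcomp when_def split: if_splits)

lemma wcomp_0 [simp]: "wcomp w c 0 = 0"
  by (rule poly_mapping_eqI) (simp add: lookup_wcomp)

lemma wcomp_add: "wcomp w c (f + g) = wcomp w c f + wcomp w c g"
  by (rule poly_mapping_eqI) (simp add: lookup_wcomp lookup_add when_add_distrib)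

lemma wcomp_sum: "wcomp w c (sum f A) = (\<Sum>i\<in>A. wcomp w c (f i))"
  by (induction A rule: infinite_finite_induct) (simp_all add: wcomp_add)

lemma wcomp_eq_self: "(\<And>m. m \<in> keys f \<Longrightarrow> weight w m = c) \<Longrightarrow> wcomp w c f = f"
  by (rule poly_mapping_eqI) (auto simp: lookup_wcomp when_def in_keys_iff)

lemma wcomp_eq_0: "(\<And>m. m \<in> keys f \<Longrightarrow> weight w m \<noteq> c) \<Longrightarrow> wcomp w c f = 0"
  by (rule poly_mapping_eqI) (auto simp: lookup_wcomp when_def in_keys_iff)

lemma initial_form_eq_wcomp:
  "initial_form w f = wcomp w (Min (weight w ` keys f)) f"
  by (rule poly_mapping_eqI)
    (auto simp: initial_form_def lookup_sum lookup_wcomp lookup_single when_def in_keys_iff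
       sum.delta' cong: if_cong)

text \<open>All terms of \<open>f\<close> have weight at least \<open>c\<close>.\<close>

definition wge :: "('v \<Rightarrow> rat) \<Rightarrow> rat \<Rightarrow> 'v cpoly \<Rightarrow> bool"
  where "wge w c f \<longleftrightarrow> (\<forall>m\<in>keys f. c \<le> weight w m)"

lemma wge_Min: "wge w (Min (weight w ` keys f)) f"
  by (auto simp: wge_def)

lemma keys_multE:
  assumes "m \<in> keys (f * g)"
  obtains a b where "a \<in> keys f" "b \<in> keys g" "m = a + b"
  using assms Poly_Mapping.keys_mult[of f g] by blast

lemma wge_mult: "wge w c f \<Longrightarrow> wge w d g \<Longrightarrow> wge w (c + d) (f * g)"
  unfolding wge_def by (metis add_mono keys_multE weight_add)

lemma wge_1: "wge w 0 1"
  by (simp add: wge_def)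

lemma wcomp_1: "wcomp w 0 1 = 1"
  by (rule wcomp_eq_self) simp

text \<open>Components at lower bounds of the weights are multiplicative.\<close>

lemma wcomp_mult:
  assumes f: "wge w c f" and g: "wge w d g"
  shows "wcomp w (c + d) (f * g) = wcomp w c f * wcomp w d g"
proof -
  define f1 where "f1 = f - wcomp w c f"
  define g1 where "g1 = g - wcomp w d g"
  have kf: "c < weight w m" if "m \<in> keys f1" for m
  proof -
    have "weight w m \<noteq> c" "m \<in> keys f"
      using that by (auto simp: f1_def in_keys_iff lookup_minus lookup_wcomp when_def split: if_splits)
    then show ?thesis using f by (force simp: wge_def)
  qed
  have kg: "d < weight w m" if "m \<in> keys g1" for m
  proof -
    have "weight w m \<noteq> d" "m \<in> keys g"
      using that by (auto simp: g1_def in_keys_iff lookup_minus lookup_wcomp when_def split: if_splits)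
    then show ?thesis using g by (force simp: wge_def)
  qed
  have "f * g = wcomp w c f * wcomp w d g + (f1 * wcomp w d g + f * g1)"
    by (simp add: f1_def g1_def algebra_simps)
  moreover have "wcomp w (c + d) (wcomp w c f * wcomp w d g) = wcomp w c f * wcomp w d g"
    by (rule wcomp_eq_self) (auto elim!: keys_multE simp: keys_wcomp)
  moreover have "wcomp w (c + d) (f1 * wcomp w d g) = 0"
    by (rule wcomp_eq_0) (use kf in \<open>force elim!: keys_multE simp: keys_wcomp\<close>)
  moreover have "wcomp w (c + d) (f * g1) = 0"
  proof (rule wcomp_eq_0)
    fix m assume "m \<in> keys (f * g1)"
    then obtain a b where "a \<in> keys f" "b \<in> keys g1" "m = a + b" by (rule keys_multE)
    then have "c \<le> weight w a" "d < weight w b" "weight w m = weight w a + weight w b"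
      using f kg by (auto simp: wge_def)
    then show "weight w m \<noteq> c + d" by linarith
  qed
  ultimately show ?thesis by (simp add: wcomp_add)
qed


section \<open>Substitutions\<close>

lemma cpoly_sum_singles: "f = (\<Sum>m\<in>keys f. single m (lookup f m))"
  by (rule poly_mapping_eqI)
    (auto simp: lookup_sum lookup_single when_def in_keys_iff sum.delta' cong: if_cong)

text \<open>The homomorphism that replaces every variable \<open>v\<close> by the polynomial \<open>\<sigma> v\<close>, on exponent
  vectors and on polynomials.  Source and target may have different types of variables.\<close>

definition msubst :: "('v \<Rightarrow> 'u cpoly) \<Rightarrow> 'v expo \<Rightarrow> 'u cpoly"
  where "msubst \<sigma> m = (\<Prod>v\<in>keys m. \<sigma> v ^ lookup m v)"

definition subst :: "('v \<Rightarrow> 'u cpoly) \<Rightarrow> 'v cpoly \<Rightarrow> 'u cpoly"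
  where "subst \<sigma> f = (\<Sum>m\<in>keys f. single 0 (lookup f m) * msubst \<sigma> m)"

lemma msubst_superset:
  assumes "finite A" "keys m \<subseteq> A"
  shows "msubst \<sigma> m = (\<Prod>v\<in>A. \<sigma> v ^ lookup m v)"
  unfolding msubst_def
  by (rule prod.mono_neutral_left) (use assms in \<open>auto simp: in_keys_iff\<close>)

lemma msubst_0 [simp]: "msubst \<sigma> 0 = 1"
  by (simp add: msubst_def)

lemma msubst_single [simp]: "msubst \<sigma> (single v k) = \<sigma> v ^ k"
  by (cases "k = 0") (simp_all add: msubst_def)

lemma msubst_add: "msubst \<sigma> (m + m') = msubst \<sigma> m * msubst \<sigma> m'"
proof -
  let ?A = "keys m \<union> keys m'"
  have "msubst \<sigma> (m + m') = (\<Prod>v\<in>?A. \<sigma> v ^ lookup (m + m') v)"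
    by (rule msubst_superset) (use Poly_Mapping.keys_add[of m m'] in auto)
  also have "\<dots> = (\<Prod>v\<in>?A. \<sigma> v ^ lookup m v) * (\<Prod>v\<in>?A. \<sigma> v ^ lookup m' v)"
    by (simp add: lookup_add power_add prod.distrib)
  also have "\<dots> = msubst \<sigma> m * msubst \<sigma> m'"
    by (subst (1 2) msubst_superset[where A = ?A]) auto
  finally show ?thesis .
qed

lemma subst_superset:
  assumes "finite A" "keys f \<subseteq> A"
  shows "subst \<sigma> f = (\<Sum>m\<in>A. single 0 (lookup f m) * msubst \<sigma> m)"
  unfolding subst_def
  by (rule sum.mono_neutral_left) (use assms in \<open>auto simp: in_keys_iff\<close>)

lemma subst_0 [simp]: "subst \<sigma> 0 = 0"
  by (simp add: subst_def)

lemma subst_single: "subst \<sigma> (single m c) = single 0 c * msubst \<sigma> m"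
  by (cases "c = 0") (simp_all add: subst_def)

lemma subst_add: "subst \<sigma> (f + g) = subst \<sigma> f + subst \<sigma> g"
proof -
  let ?A = "keys f \<union> keys g"
  have "subst \<sigma> (f + g) = (\<Sum>m\<in>?A. single 0 (lookup (f + g) m) * msubst \<sigma> m)"
    by (rule subst_superset) (use Poly_Mapping.keys_add[of f g] in auto)
  also have "\<dots> = (\<Sum>m\<in>?A. single 0 (lookup f m) * msubst \<sigma> m) +
      (\<Sum>m\<in>?A. single 0 (lookup g m) * msubst \<sigma> m)"
    by (simp add: lookup_add single_add distrib_right sum.distrib)
  also have "\<dots> = subst \<sigma> f + subst \<sigma> g"
    by (subst (1 2) subst_superset[where A = ?A]) auto
  finally show ?thesis .
qed

lemma subst_sum: "subst \<sigma> (sum f A) = (\<Sum>i\<in>A. subst \<sigma> (f i))"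
  by (induction A rule: infinite_finite_induct) (simp_all add: subst_add)

lemma subst_uminus: "subst \<sigma> (- f) = - subst \<sigma> f"
  using subst_add[of \<sigma> f "- f"] by (simp add: eq_neg_iff_add_eq_0 add.commute)

lemma subst_diff: "subst \<sigma> (f - g) = subst \<sigma> f - subst \<sigma> g"
  using subst_add[of \<sigma> f "- g"] by (simp add: subst_uminus)

lemma const_mult: "single 0 (a * b) = (single 0 a * single 0 b :: 'u cpoly)"
  by (simp add: mult_single)

lemma subst_mult: "subst \<sigma> (f * g) = subst \<sigma> f * subst \<sigma> g"
proof -
  have "subst \<sigma> (f * g) =
    subst \<sigma> ((\<Sum>m\<in>keys f. single m (lookup f m)) * (\<Sum>k\<in>keys g. single k (lookup g k)))"
    by (simp flip: cpoly_sum_singles)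
  also have "\<dots> = (\<Sum>m\<in>keys f. \<Sum>k\<in>keys g.
      (single 0 (lookup f m) * msubst \<sigma> m) * (single 0 (lookup g k) * msubst \<sigma> k))"
  proof -
    have "single 0 (a * b) * (msubst \<sigma> m * msubst \<sigma> k) =
      (single 0 a * msubst \<sigma> m) * (single 0 b * msubst \<sigma> k)" for a b :: complex and m k
      by (simp only: const_mult ac_simps)
    then show ?thesis
      by (simp add: sum_product subst_sum mult_single subst_single msubst_add)
  qed
  also have "\<dots> = subst \<sigma> f * subst \<sigma> g"
    by (simp add: subst_def sum_product)
  finally show ?thesis .
qed

lemma subst_1 [simp]: "subst \<sigma> 1 = 1"
  using subst_single[of \<sigma> 0 1] by simp

lemma subst_power: "subst \<sigma> (f ^ k) = subst \<sigma> f ^ k"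
  by (induction k) (simp_all add: subst_mult)

lemma subst_var [simp]: "subst \<sigma> (var v) = \<sigma> v"
  by (simp add: var_def monomial_def subst_single)

text \<open>If the terms of \<open>\<sigma> v\<close> have weight at least \<open>w v\<close>, then taking lowest components commutes with
  substitution (\<open>wcomp_subst\<close>).\<close>

lemma wge_wcomp_power:
  assumes "wge w c f"
  shows "wge w (c * of_nat k) (f ^ k) \<and> wcomp w (c * of_nat k) (f ^ k) = wcomp w c f ^ k"
proof (induction k)
  case 0
  then show ?case by (simp add: wge_1 wcomp_1)
next
  case (Suc k)
  then show ?case
    using wge_mult[OF assms, of "c * of_nat k" "f ^ k"]
      wcomp_mult[OF assms, of "c * of_nat k" "f ^ k"] by (simp add: algebra_simps)
qed

lemma wge_wcomp_msubst:
  assumes "\<And>v. v \<in> keys m \<Longrightarrow> wge w' (w v) (\<sigma> v)"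
  shows "wge w' (weight w m) (msubst \<sigma> m) \<and>
    wcomp w' (weight w m) (msubst \<sigma> m) = msubst (\<lambda>v. wcomp w' (w v) (\<sigma> v)) m"
proof -
  have "wge w' (\<Sum>v\<in>B. w v * of_nat (lookup m v)) (\<Prod>v\<in>B. \<sigma> v ^ lookup m v) \<and>
    wcomp w' (\<Sum>v\<in>B. w v * of_nat (lookup m v)) (\<Prod>v\<in>B. \<sigma> v ^ lookup m v) =
    (\<Prod>v\<in>B. wcomp w' (w v) (\<sigma> v) ^ lookup m v)" if "finite B" "B \<subseteq> keys m" for B
    using that
  proof (induction B rule: finite_induct)
    case empty
    then show ?case by (simp add: wge_1 wcomp_1)
  next
    case (insert v B)
    have v: "wge w' (w v * of_nat (lookup m v)) (\<sigma> v ^ lookup m v)"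
      "wcomp w' (w v * of_nat (lookup m v)) (\<sigma> v ^ lookup m v) = wcomp w' (w v) (\<sigma> v) ^ lookup m v"
      using wge_wcomp_power[of w' "w v" "\<sigma> v"] assms[of v] insert.prems by auto
    show ?case
      using insert v by (simp add: wge_mult wcomp_mult)
  qed
  from this[of "keys m"] show ?thesis
    by (simp add: weight_def msubst_def)
qed

lemma wcomp_const_mult: "wcomp w c (single 0 a * f) = single 0 a * wcomp w c f"
  for f :: "'v cpoly"
proof (cases "f = 0")
  case False
  have *: "lookup (single 0 a * g) m = a * lookup g m" for g :: "'v cpoly" and m
    by (simp flip: mult_map_scale_conv_mult add: Poly_Mapping.map.rep_eq when_def)
  show ?thesis
    by (rule poly_mapping_eqI) (simp add: lookup_wcomp * when_def)
qed simp

lemma wcomp_subst: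
  assumes \<sigma>: "\<And>v. v \<in> V \<Longrightarrow> wge w' (w v) (\<sigma> v)" and f: "f \<in> polys_in V" "wge w c f"
  shows "wcomp w' c (subst \<sigma> f) = subst (\<lambda>v. wcomp w' (w v) (\<sigma> v)) (wcomp w c f)"
proof -
  let ?s = "\<lambda>v. wcomp w' (w v) (\<sigma> v)"
  have "wcomp w' c (subst \<sigma> f) =
      (\<Sum>m\<in>keys f. single 0 (lookup f m) * wcomp w' c (msubst \<sigma> m))"
    by (simp add: subst_def wcomp_sum wcomp_const_mult)
  also have "\<dots> = (\<Sum>m\<in>keys f. single 0 (lookup (wcomp w c f) m) * msubst ?s m)"
  proof (rule sum.cong)
    fix m assume m: "m \<in> keys f"
    then have "wge w' (weight w m) (msubst \<sigma> m)"
      and eq: "wcomp w' (weight w m) (msubst \<sigma> m) = msubst ?s m"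
      using wge_wcomp_msubst[of m w' w \<sigma>] \<sigma> f(1) by (auto simp: polys_in_def)
    moreover have "c \<le> weight w m" using m f(2) by (auto simp: wge_def)
    ultimately show "single 0 (lookup f m) * wcomp w' c (msubst \<sigma> m) =
        single 0 (lookup (wcomp w c f) m) * msubst ?s m"
      using wcomp_eq_0[of "msubst \<sigma> m" w' c]
      by (cases "weight w m = c") (force simp: lookup_wcomp wge_def)+
  qed simp
  also have "\<dots> = subst ?s (wcomp w c f)"
    by (rule subst_superset[symmetric]) (auto simp: keys_wcomp)
  finally show ?thesis .
qed

text \<open>The exponent vector of the image of a monomial under a monomial substitution
  \<open>v \<mapsto> x\<^bsup>\<psi> v\<^esup>\<close>.\<close>

definition expo_subst :: "('v \<Rightarrow> 'u expo) \<Rightarrow> 'v expo \<Rightarrow> 'u expo"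
  where "expo_subst \<psi> m = (\<Sum>v\<in>keys m. \<Sum>i<lookup m v. \<psi> v)"

lemma lookup_expo_subst: "lookup (expo_subst \<psi> m) u = (\<Sum>v\<in>keys m. lookup m v * lookup (\<psi> v) u)"
  by (simp add: expo_subst_def lookup_sum)

lemma lookup_expo_subst_superset:
  assumes "finite A" "keys m \<subseteq> A"
  shows "lookup (expo_subst \<psi> m) u = (\<Sum>v\<in>A. lookup m v * lookup (\<psi> v) u)"
  unfolding lookup_expo_subst
  by (rule sum.mono_neutral_left) (use assms in \<open>auto simp: in_keys_iff\<close>)

lemma expo_subst_add: "expo_subst \<psi> (m + m') = expo_subst \<psi> m + expo_subst \<psi> m'"
proof (rule poly_mapping_eqI)
  fix u
  have fin: "finite (keys m \<union> keys m')" by simp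
  show "lookup (expo_subst \<psi> (m + m')) u = lookup (expo_subst \<psi> m + expo_subst \<psi> m') u"
    using Poly_Mapping.keys_add[of m m']
    by (simp add: lookup_add lookup_expo_subst_superset[OF fin] sum.distrib distrib_right)
qed

lemma single_power: "single k c ^ j = single (\<Sum>i<j. k) (c ^ j)"
  for k :: "'u expo" and c :: complex
  by (induction j) (simp_all add: mult_single add.commute)

lemma msubst_monomials:
  "msubst (\<lambda>v. single (\<psi> v) (c v)) m = single (expo_subst \<psi> m) (\<Prod>v\<in>keys m. c v ^ lookup m v)"
proof -
  have "(\<Prod>v\<in>B. single (\<psi> v) (c v) ^ lookup m v) =
      single (\<Sum>v\<in>B. \<Sum>i<lookup m v. \<psi> v) (\<Prod>v\<in>B. c v ^ lookup m v)" if "finite B" for B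
    using that
    by (induction B rule: finite_induct) (simp_all add: single_power mult_single)
  then show ?thesis by (simp add: msubst_def expo_subst_def)
qed

lemma msubst_cong: "(\<And>v. v \<in> keys m \<Longrightarrow> \<sigma> v = \<tau> v) \<Longrightarrow> msubst \<sigma> m = msubst \<tau> m"
  by (simp add: msubst_def)

text \<open>A monomial substitution that separates the monomials of \<open>f\<close> does not kill \<open>f\<close>.\<close>

lemma subst_monomials_inj:
  assumes f: "f \<in> polys_in V" "keys f \<subseteq> S" and inj: "inj_on (expo_subst \<psi>) S"
    and \<sigma>: "\<And>v. v \<in> V \<Longrightarrow> \<sigma> v = single (\<psi> v) (c v) \<and> c v \<noteq> 0"
    and 0: "subst \<sigma> f = 0"
  shows "f = 0"
proof (rule ccontr)
  assume "f \<noteq> 0"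
  then obtain m0 where m0: "m0 \<in> keys f" by (metis keys_eq_empty ex_in_conv)
  define C where "C m = (\<Prod>v\<in>keys m. c v ^ lookup m v)" for m
  have "subst \<sigma> f = (\<Sum>m\<in>keys f. single (expo_subst \<psi> m) (lookup f m * C m))"
    unfolding subst_def
  proof (rule sum.cong)
    fix m assume "m \<in> keys f"
    then have "msubst \<sigma> m = msubst (\<lambda>v. single (\<psi> v) (c v)) m"
      using f(1) \<sigma> by (intro msubst_cong) (auto simp: polys_in_def)
    then show "single 0 (lookup f m) * msubst \<sigma> m = single (expo_subst \<psi> m) (lookup f m * C m)"
      by (simp add: msubst_monomials mult_single C_def)
  qed simp
  then have "0 = (\<Sum>m\<in>keys f. lookup f m * C m when expo_subst \<psi> m = expo_subst \<psi> m0)"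
    using 0 by (metis (no_types, lifting) lookup_single lookup_sum lookup_zero sum.cong)
  also have "\<dots> = (\<Sum>m\<in>keys f. lookup f m * C m when m = m0)"
  proof (rule sum.cong)
    fix m assume "m \<in> keys f"
    then have "expo_subst \<psi> m = expo_subst \<psi> m0 \<longleftrightarrow> m = m0"
      using inj f(2) m0 by (metis inj_onD subsetD)
    then show "(lookup f m * C m when expo_subst \<psi> m = expo_subst \<psi> m0) =
      (lookup f m * C m when m = m0)" by simp
  qed simp
  also have "\<dots> = lookup f m0 * C m0"
    using m0 by (simp add: when_def)
  finally show False
    using m0 \<sigma> f(1) by (auto simp: C_def in_keys_iff polys_in_def subset_iff)
qed


section \<open>Ideals of the polynomial ring\<close>

lemma carrier_poly_ring: "carrier (poly_ring V) = polys_in V"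
  by (simp add: poly_ring_def)

lemma ring_poly_ring: "ring (poly_ring V)"
  using cring_poly_ring by (rule cring.axioms)

lemma polys_in_single: "keys m \<subseteq> V \<Longrightarrow> single m c \<in> polys_in V"
  by (auto simp: polys_in_def)

lemma ideal_in_polys: "ideal Q (poly_ring V) \<Longrightarrow> f \<in> Q \<Longrightarrow> f \<in> polys_in V"
  using ideal.Icarr[of Q "poly_ring V" f] by (simp add: carrier_poly_ring)

lemma ideal_0: "ideal Q (poly_ring V) \<Longrightarrow> 0 \<in> Q"
  using additive_subgroup.zero_closed[OF ideal.axioms(1), of Q "poly_ring V"]
  by (simp add: poly_ring_def)

lemma ideal_add: "ideal Q (poly_ring V) \<Longrightarrow> f \<in> Q \<Longrightarrow> g \<in> Q \<Longrightarrow> f + g \<in> Q"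
  using additive_subgroup.a_closed[OF ideal.axioms(1), of Q "poly_ring V" f g]
  by (simp add: poly_ring_def)

lemma ideal_mult: "ideal Q (poly_ring V) \<Longrightarrow> f \<in> Q \<Longrightarrow> r \<in> polys_in V \<Longrightarrow> r * f \<in> Q"
  using ideal.I_l_closed[of Q "poly_ring V" f r] by (simp add: poly_ring_def)

lemma ideal_sum:
  "ideal Q (poly_ring V) \<Longrightarrow> (\<And>i. i \<in> A \<Longrightarrow> f i \<in> Q) \<Longrightarrow> sum f A \<in> Q"
  by (induction A rule: infinite_finite_induct) (auto intro: ideal_0 ideal_add)

lemma ideal_kernel_subst: "ideal {f \<in> polys_in V. subst \<sigma> f = 0} (poly_ring V)" (is "ideal ?K _")
proof (rule idealI[OF ring_poly_ring])
  interpret ring "poly_ring V" by (rule ring_poly_ring)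
  have inv: "\<ominus>\<^bsub>poly_ring V\<^esub> f = - f" if "f \<in> polys_in V" for f
    by (rule minus_equality) (use that polys_in_uminus[of f V] in \<open>auto simp: poly_ring_def\<close>)
  show "subgroup ?K (add_monoid (poly_ring V))"
  proof
    fix f assume "f \<in> ?K"
    then show "inv\<^bsub>add_monoid (poly_ring V)\<^esub> f \<in> ?K"
      using inv[of f] by (simp add: a_inv_def polys_in_uminus subst_uminus)
  qed (auto simp: poly_ring_def polys_in_0 polys_in_add subst_add)
qed (auto simp: poly_ring_def polys_in_mult subst_mult)

lemma initial_form_polys_in: "f \<in> polys_in V \<Longrightarrow> initial_form w f \<in> polys_in V"
  by (auto simp: initial_form_eq_wcomp polys_in_def keys_wcomp)

lemma ideal_genideal: "G \<subseteq> polys_in V \<Longrightarrow> ideal (Idl\<^bsub>poly_ring V\<^esub> G) (poly_ring V)"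
  by (rule ring.genideal_ideal[OF ring_poly_ring]) (simp add: carrier_poly_ring)

lemma initial_ideal_props:
  assumes "ideal I (poly_ring V)"
  shows "ideal (initial_ideal V w I) (poly_ring V)"
    and "f \<in> I \<Longrightarrow> initial_form w f \<in> initial_ideal V w I"
proof -
  have sub: "initial_form w ` I \<subseteq> carrier (poly_ring V)"
    using ideal_in_polys[OF assms] by (auto simp: carrier_poly_ring intro: initial_form_polys_in)
  show "ideal (initial_ideal V w I) (poly_ring V)"
    unfolding initial_ideal_def by (rule ring.genideal_ideal[OF ring_poly_ring sub])
  show "initial_form w f \<in> initial_ideal V w I" if "f \<in> I"
    unfolding initial_ideal_def using ring.genideal_self[OF ring_poly_ring sub] that by blast
qed

lemma primeideal_kernel_subst:
  fixes \<sigma> :: "'v \<Rightarrow> 'u::linorder cpoly"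
  shows "primeideal {f \<in> polys_in V. subst \<sigma> f = 0} (poly_ring V)"
proof (rule primeidealI[OF ideal_kernel_subst cring_poly_ring])
  have "1 \<in> polys_in V - {f \<in> polys_in V. subst \<sigma> f = 0}"
    by (simp add: polys_in_1)
  then show "carrier (poly_ring V) \<noteq> {f \<in> polys_in V. subst \<sigma> f = 0}"
    unfolding carrier_poly_ring by blast
qed (auto simp: poly_ring_def subst_mult)

lemma initial_form_strict_min:
  assumes "m0 \<in> keys f" "\<And>k. k \<in> keys f \<Longrightarrow> k \<noteq> m0 \<Longrightarrow> weight w m0 < weight w k"
  shows "initial_form w f = single m0 (lookup f m0)"
proof -
  have Min: "Min (weight w ` keys f) = weight w m0"
    by (rule Min_eqI) (use assms in \<open>auto simp: less_le\<close>)
  show ?thesis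
    unfolding initial_form_eq_wcomp Min
    by (rule poly_mapping_eqI)
      (use assms(2) in \<open>force simp: lookup_wcomp lookup_single when_def in_keys_iff\<close>)
qed

text \<open>At a tropical point the minimal weight of an element of the ideal is attained twice.\<close>

lemma trop_not_strict_min:
  assumes I: "ideal I (poly_ring V)" and w: "w \<in> trop V I" and f: "f \<in> I" and m0: "m0 \<in> keys f"
  shows "\<exists>k\<in>keys f. k \<noteq> m0 \<and> weight w k \<le> weight w m0"
proof (rule ccontr)
  assume "\<not> ?thesis"
  then have "initial_form w f = single m0 (lookup f m0)"
    by (intro initial_form_strict_min m0) (auto simp: not_le)
  then have "single m0 (lookup f m0) \<in> initial_ideal V w I"
    using initial_ideal_props(2)[OF I f] by metis
  then have "single 0 (inverse (lookup f m0)) * single m0 (lookup f m0) \<in> initial_ideal V w I"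
    by (rule ideal_mult[OF initial_ideal_props(1)[OF I]]) (simp add: polys_in_single)
  moreover have "single 0 (inverse (lookup f m0)) * single m0 (lookup f m0) = monomial m0"
    using m0 by (simp add: mult_single monomial_def in_keys_iff)
  moreover have "keys m0 \<subseteq> V"
    using ideal_in_polys[OF I f] m0 by (auto simp: polys_in_def)
  ultimately show False
    using w by (auto simp: trop_def)
qed


section \<open>A criterion for prime initial ideals\<close>

text \<open>In the criterion, \<open>\<psi> v\<close> is the unique term of \<open>\<sigma> v\<close> that is minimal for the weight \<open>w'\<close>, with
  ties broken by the weight \<open>t\<close>.  The assumption \<open>red\<close> says that a monomial outside \<open>S\<close> is divisible by
  a term \<open>m0\<close> of a generator that survives in the initial form and dominates the other terms with
  respect to the grading \<open>\<mu>\<close>.  Thus the grading serves as termination measure of a rewriting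
  system whose normal forms are the monomials in \<open>S\<close>.\<close>

theorem initial_ideal_primeI:
  fixes V :: "'v set" and \<sigma> :: "'v \<Rightarrow> 'u::linorder cpoly"
  assumes G: "G \<subseteq> polys_in V"
    and zero: "\<And>g. g \<in> G \<Longrightarrow> subst \<sigma> g = 0"
    and lead: "\<And>v. v \<in> V \<Longrightarrow> \<psi> v \<in> keys (\<sigma> v)"
    and lead_weight: "\<And>v. v \<in> V \<Longrightarrow> weight w' (\<psi> v) = w v"
    and other: "\<And>v m. v \<in> V \<Longrightarrow> m \<in> keys (\<sigma> v) \<Longrightarrow> m \<noteq> \<psi> v \<Longrightarrow>
      w v < weight w' m \<or> w v = weight w' m \<and> weight t (\<psi> v) < weight t m"
    and inj: "inj_on (expo_subst \<psi>) S"
    and red: "\<And>m. keys m \<subseteq> V \<Longrightarrow> m \<notin> S \<Longrightarrow> \<exists>g\<in>G. \<exists>m0\<in>keys g. \<exists>r. m = m0 + r \<and>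
      (\<forall>k\<in>keys g. weight w m0 \<le> weight w k) \<and>
      (\<forall>k\<in>keys g. k \<noteq> m0 \<longrightarrow> weight (\<lambda>v. of_nat (\<mu> v)) k < weight (\<lambda>v. of_nat (\<mu> v)) m0)"
  shows "primeideal (initial_ideal V w (Idl\<^bsub>poly_ring V\<^esub> G)) (poly_ring V)"
proof -
  let ?R = "poly_ring V"
  define I where "I = Idl\<^bsub>?R\<^esub> G"
  define Q where "Q = initial_ideal V w I"
  define \<sigma>1 where "\<sigma>1 v = wcomp w' (w v) (\<sigma> v)" for v
  define P where "P = {f \<in> polys_in V. subst \<sigma>1 f = 0}"
  have I: "ideal I ?R" unfolding I_def by (rule ideal_genideal[OF G])
  have Q: "ideal Q ?R" unfolding Q_def by (rule initial_ideal_props(1)[OF I])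
  have "G \<subseteq> I"
    unfolding I_def by (rule ring.genideal_self[OF ring_poly_ring]) (use G in \<open>simp add: carrier_poly_ring\<close>)
  have wge: "wge w' (w v) (\<sigma> v)" if "v \<in> V" for v
    unfolding wge_def using lead_weight[OF that] other[OF that] by (metis less_le order.refl)
  have "Q \<subseteq> P"
    unfolding Q_def initial_ideal_def
  proof (rule ring.genideal_minimal[OF ring_poly_ring])
    show "ideal P ?R" unfolding P_def by (rule ideal_kernel_subst)
    have "I \<subseteq> {f \<in> polys_in V. subst \<sigma> f = 0}"
      unfolding I_def
      by (rule ring.genideal_minimal[OF ring_poly_ring ideal_kernel_subst]) (use G zero in auto)
    then have f: "f \<in> polys_in V" "subst \<sigma> f = 0" if "f \<in> I" for f using that by auto
    have "subst \<sigma>1 (initial_form w f) = 0" if "f \<in> I" for f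
    proof -
      let ?c = "Min (weight w ` keys f)"
      have "wcomp w' ?c (subst \<sigma> f) = subst (\<lambda>v. wcomp w' (w v) (\<sigma> v)) (wcomp w ?c f)"
        by (rule wcomp_subst[OF wge f(1)[OF that] wge_Min])
      moreover have "\<sigma>1 = (\<lambda>v. wcomp w' (w v) (\<sigma> v))" by (simp add: \<sigma>1_def fun_eq_iff)
      ultimately show ?thesis using f(2)[OF that] by (simp add: initial_form_eq_wcomp)
    qed
    then show "initial_form w ` I \<subseteq> P"
      using f(1) by (auto simp: P_def initial_form_polys_in)
  qed
  \<comment> \<open>Every polynomial is congruent modulo \<open>Q\<close> to a combination of monomials in \<open>S\<close>.\<close>
  define N where "N m = (\<Sum>v\<in>keys m. \<mu> v * lookup m v)" for m :: "'v expo"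
  have N: "weight (\<lambda>v. of_nat (\<mu> v)) m = of_nat (N m)" for m
    by (simp add: weight_of_nat N_def)
  have N_add: "N (m + k) = N m + N k" for m k
    using weight_add[of "\<lambda>v. of_nat (\<mu> v)" m k] by (simp add: N flip: of_nat_add)
  have mono_red: "\<exists>g\<in>polys_in V. keys g \<subseteq> S \<and> single m c - g \<in> Q" if "keys m \<subseteq> V" for m c
    using that
  proof (induction "N m" arbitrary: m c rule: less_induct)
    case less
    show ?case
    proof (cases "m \<in> S")
      case True
      then show ?thesis
        by (intro bexI[of _ "single m c"]) (use ideal_0[OF Q] less.prems in \<open>auto simp: polys_in_single\<close>)
    next
      case False
      from red[OF less.prems this] obtain g m0 r where g: "g \<in> G" "m0 \<in> keys g" "m = m0 + r"
        and min: "\<And>k. k \<in> keys g \<Longrightarrow> weight w m0 \<le> weight w k"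
        and N_less: "\<And>k. k \<in> keys g \<Longrightarrow> k \<noteq> m0 \<Longrightarrow> N k < N m0"
        unfolding N by (metis of_nat_less_iff)
      define h where "h = initial_form w g"
      have "Min (weight w ` keys g) = weight w m0"
        by (rule Min_eqI) (use g(2) min in auto)
      then have h: "keys h \<subseteq> keys g" "m0 \<in> keys h"
        using g(2) by (auto simp: h_def initial_form_eq_wcomp keys_wcomp)
      have "h \<in> Q"
        unfolding Q_def h_def by (rule initial_ideal_props(2)[OF I]) (use g(1) \<open>G \<subseteq> I\<close> in auto)
      have keys_sum: "keys (k + r) \<subseteq> V" if "k \<in> keys g" for k
      proof -
        have "keys k \<subseteq> V" using that g(1) G by (auto simp: polys_in_def)
        moreover have "keys r \<subseteq> keys m" by (auto simp: g(3) in_keys_iff lookup_add)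
        ultimately show ?thesis using less.prems Poly_Mapping.keys_add[of k r] by blast
      qed
      define d where "d = c / lookup h m0"
      define K where "K = keys h - {m0}"
      have "\<exists>e\<in>polys_in V. keys e \<subseteq> S \<and> single (k + r) (- d * lookup h k) - e \<in> Q" if "k \<in> K" for k
      proof (rule less.hyps)
        show "N (k + r) < N m" using that h N_less by (auto simp: g(3) N_add K_def)
        show "keys (k + r) \<subseteq> V" using that h by (intro keys_sum) (auto simp: K_def)
      qed
      then obtain e where e: "\<And>k. k \<in> K \<Longrightarrow> e k \<in> polys_in V" "\<And>k. k \<in> K \<Longrightarrow> keys (e k) \<subseteq> S"
        "\<And>k. k \<in> K \<Longrightarrow> single (k + r) (- d * lookup h k) - e k \<in> Q" by metis
      \<comment> \<open>\<open>d\<close> is chosen such that \<open>m0\<close> contributes exactly the term \<open>single m c\<close>.\<close>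
      have "single r d * h = (\<Sum>k\<in>keys h. single r d * single k (lookup h k))"
        by (subst cpoly_sum_singles[of h]) (simp add: sum_distrib_left)
      also have "\<dots> = single m c + (\<Sum>k\<in>K. single (k + r) (d * lookup h k))"
        using h(2) by (simp add: sum.remove[of _ m0] K_def mult_single add.commute g(3) d_def in_keys_iff)
      finally have "single m c - (\<Sum>k\<in>K. e k) =
          single r d * h + (\<Sum>k\<in>K. single (k + r) (- d * lookup h k) - e k)"
        by (simp add: sum_subtractf single_uminus sum_negf)
      moreover have "single r d * h \<in> Q"
      proof (rule ideal_mult[OF Q \<open>h \<in> Q\<close> polys_in_single])
        show "keys r \<subseteq> V" using less.prems by (auto simp: g(3) in_keys_iff lookup_add)
      qed
      ultimately have "single m c - (\<Sum>k\<in>K. e k) \<in> Q"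
        using e(3) by (auto intro!: ideal_add[OF Q] ideal_sum[OF Q])
      moreover have "keys (\<Sum>k\<in>K. e k) \<subseteq> S"
        using Poly_Mapping.keys_sum[of e K] e(2) by blast
      ultimately show ?thesis using e(1) by (intro bexI[of _ "\<Sum>k\<in>K. e k"]) (auto intro: polys_in_sum)
    qed
  qed
  have "P \<subseteq> Q"
  proof
    fix f assume "f \<in> P"
    then have f: "f \<in> polys_in V" "subst \<sigma>1 f = 0" by (auto simp: P_def)
    have "\<exists>g\<in>polys_in V. keys g \<subseteq> S \<and> single m (lookup f m) - g \<in> Q" if "m \<in> keys f" for m
      by (rule mono_red) (use f(1) that in \<open>auto simp: polys_in_def\<close>)
    then obtain e where e: "\<And>k. k \<in> keys f \<Longrightarrow> e k \<in> polys_in V" "\<And>k. k \<in> keys f \<Longrightarrow> keys (e k) \<subseteq> S"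
        "\<And>k. k \<in> keys f \<Longrightarrow> single k (lookup f k) - e k \<in> Q" by metis
    define g where "g = (\<Sum>k\<in>keys f. e k)"
    have "f - g = (\<Sum>k\<in>keys f. single k (lookup f k) - e k)"
      unfolding g_def by (subst cpoly_sum_singles[of f]) (simp add: sum_subtractf)
    then have fg: "f - g \<in> Q" using e(3) by (auto intro!: ideal_sum[OF Q])
    have gV: "g \<in> polys_in V" unfolding g_def using e(1) by (rule polys_in_sum)
    have gS: "keys g \<subseteq> S" unfolding g_def using Poly_Mapping.keys_sum[of e "keys f"] e(2) by blast
    have "subst \<sigma>1 g = 0"
      using fg \<open>Q \<subseteq> P\<close> f(2) by (auto simp: P_def subst_diff)
    \<comment> \<open>The component of \<open>g\<close> of lowest \<open>t'\<close>-weight is killed by the leading monomial substitution.\<close>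
    have "g = 0"
    proof (rule ccontr)
      assume "g \<noteq> 0"
      define t' where "t' v = weight t (\<psi> v)" for v
      define c where "c = Min (weight t' ` keys g)"
      have "c \<in> weight t' ` keys g"
        unfolding c_def by (rule Min_in) (use \<open>g \<noteq> 0\<close> in auto)
      moreover have "wcomp t' c g = 0"
      proof (rule subst_monomials_inj[where V = V and S = S and \<psi> = \<psi>])
        show "wcomp t' c g \<in> polys_in V" "keys (wcomp t' c g) \<subseteq> S"
          using gV gS by (auto simp: polys_in_def keys_wcomp)
        show "wcomp t (t' v) (\<sigma>1 v) = single (\<psi> v) (lookup (\<sigma> v) (\<psi> v)) \<and> lookup (\<sigma> v) (\<psi> v) \<noteq> 0"
          if "v \<in> V" for v
        proof
          show "wcomp t (t' v) (\<sigma>1 v) = single (\<psi> v) (lookup (\<sigma> v) (\<psi> v))"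
          proof (rule poly_mapping_eqI)
            fix m
            show "lookup (wcomp t (t' v) (\<sigma>1 v)) m = lookup (single (\<psi> v) (lookup (\<sigma> v) (\<psi> v))) m"
            proof (cases "m = \<psi> v")
              case True
              then show ?thesis using lead_weight[OF that] by (simp add: lookup_wcomp \<sigma>1_def t'_def)
            next
              case False
              then have "lookup (\<sigma> v) m = 0 \<or> weight w' m \<noteq> w v \<or> weight t m \<noteq> t' v"
                using other[OF that, of m] by (auto simp: in_keys_iff t'_def)
              then show ?thesis using False by (auto simp: lookup_wcomp \<sigma>1_def lookup_single)
            qed
          qed
          show "lookup (\<sigma> v) (\<psi> v) \<noteq> 0" using lead[OF that] by (simp add: in_keys_iff)
        qed
        have "wge t (t' v) (\<sigma>1 v)" if "v \<in> V" for v
          unfolding wge_def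
        proof
          fix m assume "m \<in> keys (\<sigma>1 v)"
          then show "t' v \<le> weight t m"
            using other[OF that, of m] by (cases "m = \<psi> v") (auto simp: \<sigma>1_def keys_wcomp t'_def)
        qed
        then have "wcomp t c (subst \<sigma>1 g) = subst (\<lambda>v. wcomp t (t' v) (\<sigma>1 v)) (wcomp t' c g)"
          using gV wge_Min[of t' g] by (intro wcomp_subst) (auto simp: c_def)
        then show "subst (\<lambda>v. wcomp t (t' v) (\<sigma>1 v)) (wcomp t' c g) = 0"
          using \<open>subst \<sigma>1 g = 0\<close> by simp
      qed (rule inj)
      ultimately show False
        by (auto simp flip: keys_eq_empty simp: keys_wcomp)
    qed
    then show "f \<in> Q" using fg by simp
  qed
  then have "Q = P" using \<open>Q \<subseteq> P\<close> by blast
  then show ?thesis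
    using primeideal_kernel_subst[of V \<sigma>1] by (simp add: Q_def P_def I_def)
qed


section \<open>Monomials in the variables of the two families\<close>

instance vars :: countable
  by countable_datatype

text \<open>Any linear order on the variables will do: it makes the polynomial ring an instance of
  \<open>idom\<close>.\<close>

instantiation vars :: linorder
begin

definition less_eq_vars :: "vars \<Rightarrow> vars \<Rightarrow> bool"
  where "less_eq_vars u v \<longleftrightarrow> to_nat u \<le> to_nat v"

definition less_vars :: "vars \<Rightarrow> vars \<Rightarrow> bool"
  where "less_vars u v \<longleftrightarrow> to_nat u < to_nat v"

instance
  by standard (auto simp: less_eq_vars_def less_vars_def)

end

lemma var_power: "var v ^ k = single (single v k) 1"
proof (induction k)
  case (Suc k)
  have "single v (Suc k) = single v 1 + single v k" by (simp flip: single_add)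
  then show ?case using Suc by (simp add: var_def monomial_def mult_single)
qed simp

lemma keys_sum_singles:
  assumes "finite A" "inj_on e A" "\<And>i. i \<in> A \<Longrightarrow> c i \<noteq> 0"
  shows "keys (\<Sum>i\<in>A. single (e i) (c i)) = e ` A"
proof
  show "keys (\<Sum>i\<in>A. single (e i) (c i)) \<subseteq> e ` A"
    using Poly_Mapping.keys_sum[of "\<lambda>i. single (e i) (c i)" A] by (auto split: if_splits)
  show "e ` A \<subseteq> keys (\<Sum>i\<in>A. single (e i) (c i))"
  proof
    fix m assume "m \<in> e ` A"
    then obtain j where j: "j \<in> A" "m = e j" by blast
    have "lookup (\<Sum>i\<in>A. single (e i) (c i)) m = (\<Sum>i\<in>A. c i when i = j)"
      unfolding lookup_sum lookup_single
      by (rule sum.cong) (use assms(2) j in \<open>auto simp: when_def inj_on_eq_iff\<close>)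
    also have "\<dots> = c j" using assms(1) j(1) by (simp add: when_def)
    finally show "m \<in> keys (\<Sum>i\<in>A. single (e i) (c i))"
      using assms(3)[OF j(1)] by (simp add: in_keys_iff)
  qed
qed

lemma expo_le_split:
  fixes m m0 :: "'v expo"
  assumes "\<And>v. lookup m0 v \<le> lookup m v"
  obtains r where "m = m0 + r"
proof
  show "m = m0 + (m - m0)"
    by (rule poly_mapping_eqI) (simp add: lookup_add lookup_minus assms)
qed

text \<open>The exponent vectors of \<open>x\<^sub>i\<^bsup>a\<^sub>i\<^esup>\<close> and of \<open>Y\<^sub>j\<close>.\<close>

definition xe :: "(nat \<Rightarrow> nat) \<Rightarrow> nat \<Rightarrow> vars expo"
  where "xe a i = single (Xv i) (a i)"

definition ye :: "nat \<Rightarrow> vars expo"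
  where "ye j = single (Yv j) 1"

lemma lookup_xe: "lookup (xe a i) v = (if v = Xv i then a i else 0)"
  by (auto simp: xe_def lookup_single when_def)

lemma lookup_ye: "lookup (ye j) v = (if v = Yv j then 1 else 0)"
  by (auto simp: ye_def lookup_single when_def)


section \<open>The hypersurface ideals\<close>

lemma XY_vars_eq: "XY_vars n = Xv ` {..n} \<union> Yv ` {..n}"
  by (auto simp: XY_vars_def)

lemma sum_XY_vars: "(\<Sum>v\<in>XY_vars n. f v) = (\<Sum>i\<le>n. f (Xv i)) + (\<Sum>i\<le>n. f (Yv i))"
proof -
  have "(\<Sum>v\<in>XY_vars n. f v) = sum f (Xv ` {..n}) + sum f (Yv ` {..n})"
    unfolding XY_vars_eq by (rule sum.union_disjoint) auto
  then show ?thesis by (simp add: sum.reindex inj_on_def)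
qed

lemma well_poised_I_ideal: "well_poised (XY_vars n) (I_ideal n a)"
  unfolding well_poised_def
proof (intro conjI ballI)
  define f where "f = (\<Sum>j=0..n. xv j ^ a j * yv j)"
  have fV: "{f} \<subseteq> polys_in (XY_vars n)"
    using gen_in_carrier[of a n] by (simp add: f_def poly_ring_def)
  have I_eq: "I_ideal n a = Idl\<^bsub>poly_ring (XY_vars n)\<^esub> {f}"
    by (simp add: I_ideal_def f_def)
  show I: "ideal (I_ideal n a) (poly_ring (XY_vars n))"
    unfolding I_eq by (rule ideal_genideal[OF fV])
  have f_in: "f \<in> I_ideal n a"
    using ring.genideal_self[OF ring_poly_ring, of "{f}" "XY_vars n"] fV
    by (simp add: I_eq carrier_poly_ring)
  have f_eq: "f = (\<Sum>j\<le>n. single (xe a j + ye j) 1)"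
    unfolding f_def atLeast0AtMost
    by (rule sum.cong) (simp_all add: var_power, simp add: var_def monomial_def mult_single xe_def ye_def)
  have e_inj: "inj_on (\<lambda>j. xe a j + ye j) A" for A
  proof (rule inj_onI)
    fix i j assume "xe a i + ye i = xe a j + ye j"
    then have "lookup (xe a i + ye i) (Yv i) = lookup (xe a j + ye j) (Yv i)" by simp
    then show "i = j" by (simp add: lookup_add lookup_xe lookup_ye split: if_splits)
  qed
  have keys_f: "keys f = (\<lambda>j. xe a j + ye j) ` {..n}"
    unfolding f_eq by (rule keys_sum_singles[OF _ e_inj]) auto
  fix w assume w: "w \<in> trop (XY_vars n) (I_ideal n a)"
  define \<omega> where "\<omega> j = of_nat (a j) * w (Xv j) + w (Yv j)" for j
  have weight_e: "weight w (xe a j + ye j) = \<omega> j" for j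
    by (simp add: xe_def ye_def \<omega>_def)
  obtain j0 where j0: "j0 \<le> n" "\<And>j. j \<le> n \<Longrightarrow> \<omega> j0 \<le> \<omega> j"
  proof -
    have "Min (\<omega> ` {..n}) \<in> \<omega> ` {..n}" by (rule Min_in) auto
    then obtain j where "j \<le> n" "\<omega> j = Min (\<omega> ` {..n})"
      by (metis (no_types, lifting) imageE atMost_iff)
    then show ?thesis using that[of j] by simp
  qed
  \<comment> \<open>At a tropical weight a second term is minimal, too.\<close>
  obtain j1 where j1: "j1 \<le> n" "j1 \<noteq> j0" "\<omega> j1 = \<omega> j0"
  proof -
    obtain j1 where "j1 \<le> n" "xe a j1 + ye j1 \<noteq> xe a j0 + ye j0" "\<omega> j1 \<le> \<omega> j0"
      using trop_not_strict_min[OF I w f_in, of "xe a j0 + ye j0"] j0(1)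
      by (auto simp: keys_f weight_e simp del: weight_add)
    then show ?thesis using that[of j1] j0(2)[of j1] by (cases "j1 = j0") auto
  qed
  \<comment> \<open>The target variables \<open>T\<^sub>j\<close> are represented by \<open>Yv j\<close>.\<close>
  define \<sigma> :: "vars \<Rightarrow> vars cpoly" where "\<sigma> v = (case v of Xv j \<Rightarrow> single (single (Xv j) 1) 1
    | Yv j \<Rightarrow> if j = j0 then \<Sum>i\<in>{..n} - {j0}. single (xe a i + ye i) (- 1)
              else single (xe a j0 + ye j) 1
    | Zv i j \<Rightarrow> 0)" for v
  define \<psi> where "\<psi> v = (case v of Xv j \<Rightarrow> single (Xv j) 1
    | Yv j \<Rightarrow> if j = j0 then xe a j1 + ye j1 else xe a j0 + ye j
    | Zv i j \<Rightarrow> 0)" for v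
  define w' where "w' v = (case v of Xv j \<Rightarrow> w (Xv j)
    | Yv j \<Rightarrow> w (Yv j) - of_nat (a j0) * w (Xv j0) | Zv i j \<Rightarrow> 0)" for v
  define t :: "vars \<Rightarrow> rat" where "t v = (case v of Yv j \<Rightarrow> if j = j1 then 0 else 1 | _ \<Rightarrow> 0)" for v
  define S where "S = {m. keys m \<subseteq> XY_vars n \<and> \<not> (a j0 \<le> lookup m (Xv j0) \<and> 0 < lookup m (Yv j0))}"
  define \<mu> :: "vars \<Rightarrow> nat" where "\<mu> v = (if v = Yv j0 then 1 else 0)" for v
  have \<psi>_simps: "\<psi> (Xv j) = single (Xv j) 1" "\<psi> (Yv j0) = xe a j1 + ye j1"
    "j \<noteq> j0 \<Longrightarrow> \<psi> (Yv j) = xe a j0 + ye j" for j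
    by (simp_all add: \<psi>_def)
  have \<sigma>_simps: "\<sigma> (Xv j) = single (single (Xv j) 1) 1"
    "j \<noteq> j0 \<Longrightarrow> \<sigma> (Yv j) = single (xe a j0 + ye j) 1" for j
    by (simp_all add: \<sigma>_def)
  have w'_e: "weight w' (xe a j + ye j) = \<omega> j - of_nat (a j0) * w (Xv j0)" for j
    by (simp add: xe_def ye_def w'_def \<omega>_def)
  have t_e: "weight t (xe a j + ye j) = (if j = j1 then 0 else 1)" for j
    by (simp add: xe_def ye_def t_def)
  have keys_j0: "keys (\<sigma> (Yv j0)) = (\<lambda>j. xe a j + ye j) ` ({..n} - {j0})"
    unfolding \<sigma>_def by (simp, rule keys_sum_singles[OF _ e_inj]) auto
  show "primeideal (initial_ideal (XY_vars n) w (I_ideal n a)) (poly_ring (XY_vars n))"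
    unfolding I_eq
  proof (rule initial_ideal_primeI[OF fV, where \<sigma> = \<sigma> and \<psi> = \<psi> and w' = w' and t = t and S = S and \<mu> = \<mu>])
    fix g assume "g \<in> {f}"
    have "subst \<sigma> f = (\<Sum>j\<le>n. \<sigma> (Xv j) ^ a j * \<sigma> (Yv j))"
      by (simp add: f_def subst_sum subst_mult subst_power atLeast0AtMost)
    also have "\<dots> = (\<Sum>j\<le>n. xv j ^ a j * \<sigma> (Yv j))"
      by (simp add: \<sigma>_def var_def monomial_def)
    also have "\<dots> = xv j0 ^ a j0 * \<sigma> (Yv j0) + (\<Sum>j\<in>{..n} - {j0}. xv j ^ a j * \<sigma> (Yv j))"
      by (rule sum.remove) (use j0 in auto)
    also have "(\<Sum>j\<in>{..n} - {j0}. xv j ^ a j * \<sigma> (Yv j)) = (\<Sum>j\<in>{..n} - {j0}. xv j0 ^ a j0 * (single (xe a j + ye j) 1))"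
      by (rule sum.cong) (auto simp: \<sigma>_def var_power mult_single xe_def ac_simps)
    also have "xv j0 ^ a j0 * \<sigma> (Yv j0) + \<dots> = 0"
      by (simp add: \<sigma>_def single_uminus sum_negf flip: sum_distrib_left)
    finally show "subst \<sigma> g = 0" using \<open>g \<in> {f}\<close> by simp
  next
    fix v assume v: "v \<in> XY_vars n"
    show "\<psi> v \<in> keys (\<sigma> v)"
    proof (cases "v = Yv j0")
      case True
      then show ?thesis using j1 by (simp add: keys_j0 \<psi>_simps)
    next
      case False
      then consider i where "v = Xv i" | i where "v = Yv i" "i \<noteq> j0"
        using v by (auto simp: XY_vars_def)
      then show ?thesis by cases (simp_all add: \<sigma>_simps \<psi>_simps)
    qed
    show "weight w' (\<psi> v) = w v"
      using v j1(3) by (auto simp: XY_vars_def \<psi>_def w'_e simp del: weight_add)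
        (auto simp: xe_def ye_def w'_def \<omega>_def)
    fix m assume m: "m \<in> keys (\<sigma> v)" "m \<noteq> \<psi> v"
    show "w v < weight w' m \<or> w v = weight w' m \<and> weight t (\<psi> v) < weight t m"
    proof (cases "v = Yv j0")
      case True
      then obtain j where j: "j \<le> n" "j \<noteq> j0" "m = xe a j + ye j"
        using m(1) by (auto simp: keys_j0)
      have "j \<noteq> j1" using m(2) True by (auto simp: j(3) \<psi>_simps)
      moreover have "w v = \<omega> j0 - of_nat (a j0) * w (Xv j0)" by (simp add: True \<omega>_def)
      ultimately show ?thesis
        using j0(2)[OF j(1)] by (auto simp: True j(3) \<psi>_simps w'_e t_e simp del: weight_add)
    next
      case False
      then show ?thesis using v m by (auto simp: XY_vars_def \<sigma>_simps \<psi>_simps)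
    qed
  next
    show "inj_on (expo_subst \<psi>) S"
    proof -
      have fin: "finite (XY_vars n)" by (simp add: XY_vars_eq)
      define T where "T m = (\<Sum>j\<in>{..n} - {j0}. lookup m (Yv j))" for m :: "vars expo"
      have split_j0: "(\<Sum>j\<le>n. lookup m (Yv j) * lookup (\<psi> (Yv j)) u) =
          lookup m (Yv j0) * lookup (xe a j1 + ye j1) u +
          (\<Sum>j\<in>{..n} - {j0}. lookup m (Yv j) * lookup (xe a j0 + ye j) u)" for m u
        by (subst sum.remove[of _ j0]) (use j0 in \<open>auto simp: \<psi>_simps\<close>)
      have at_X: "lookup (expo_subst \<psi> m) (Xv i) = lookup m (Xv i)
          + (if i = j1 then lookup m (Yv j0) * a j1 else 0) + (if i = j0 then T m * a j0 else 0)"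
        if "keys m \<subseteq> XY_vars n" "i \<le> n" for m i
      proof -
        have "(\<Sum>j\<le>n. lookup m (Xv j) * lookup (\<psi> (Xv j)) (Xv i)) = (\<Sum>j\<le>n. lookup m (Xv j) when j = i)"
          by (rule sum.cong) (auto simp: \<psi>_simps lookup_single when_def)
        then show ?thesis
          using that(2) unfolding lookup_expo_subst_superset[OF fin that(1)] sum_XY_vars split_j0
          by (simp add: when_def lookup_add lookup_xe lookup_ye T_def sum_distrib_right)
      qed
      have at_Y: "lookup (expo_subst \<psi> m) (Yv i) =
          (if i = j1 then lookup m (Yv j0) else 0) + (if i = j0 then 0 else lookup m (Yv i))"
        if "keys m \<subseteq> XY_vars n" "i \<le> n" for m i
      proof -
        have "(\<Sum>j\<in>{..n} - {j0}. lookup m (Yv j) * lookup (xe a j0 + ye j) (Yv i)) =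
            (\<Sum>j\<in>{..n} - {j0}. lookup m (Yv j) when j = i)"
          by (rule sum.cong) (auto simp: lookup_add lookup_xe lookup_ye when_def)
        then show ?thesis
          using that(2) unfolding lookup_expo_subst_superset[OF fin that(1)] sum_XY_vars split_j0
          by (auto simp: when_def lookup_add lookup_xe lookup_ye \<psi>_simps lookup_single)
      qed
      \<comment> \<open>If \<open>m'\<close> had the larger exponent at \<open>Yv j0\<close>, then, the images being equal, its exponent at
        \<open>Xv j0\<close> would be at least \<open>a j0\<close>, so \<open>m'\<close> would not be in \<open>S\<close>.\<close>
      have le: "lookup m' (Yv j0) \<le> lookup m (Yv j0)"
        if m: "m \<in> S" "m' \<in> S" "expo_subst \<psi> m = expo_subst \<psi> m'" for m m'
      proof (rule ccontr)
        assume less: "\<not> lookup m' (Yv j0) \<le> lookup m (Yv j0)"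
        have V: "keys m \<subseteq> XY_vars n" "keys m' \<subseteq> XY_vars n" using m by (auto simp: S_def)
        note eqY = at_Y[OF V(1), unfolded m(3) at_Y[OF V(2)]]
        have "lookup m' (Yv i) = lookup m (Yv i)" if "i \<le> n" "i \<noteq> j0" "i \<noteq> j1" for i
          using eqY[OF that(1)] at_Y[OF V(2) that(1)] that by simp
        then have "(\<Sum>j\<in>{..n} - {j0} - {j1}. lookup m (Yv j)) = (\<Sum>j\<in>{..n} - {j0} - {j1}. lookup m' (Yv j))"
          by (intro sum.cong) auto
        moreover have T: "T k = lookup k (Yv j1) + (\<Sum>j\<in>{..n} - {j0} - {j1}. lookup k (Yv j))" for k
          unfolding T_def by (rule sum.remove) (use j1 in auto)
        moreover have "lookup m (Yv j0) + lookup m (Yv j1) = lookup m' (Yv j0) + lookup m' (Yv j1)"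
          using eqY[OF j1(1)] at_Y[OF V(2) j1(1)] j1 by simp
        ultimately have "T m' < T m" using less T[of m] T[of m'] by linarith
        then obtain d where "T m = T m' + Suc d" by (metis less_imp_Suc_add add_Suc_right)
        moreover have "lookup m (Xv j0) + T m * a j0 = lookup m' (Xv j0) + T m' * a j0"
          using at_X[OF V(1) j0(1)] at_X[OF V(2) j0(1)] m(3) j1(2) by simp
        ultimately have "a j0 \<le> lookup m' (Xv j0)" by (simp add: algebra_simps)
        then show False using m(2) less by (auto simp: S_def)
      qed
      show ?thesis
      proof (rule inj_onI)
        fix m m' assume m: "m \<in> S" "m' \<in> S" "expo_subst \<psi> m = expo_subst \<psi> m'"
        then have V: "keys m \<subseteq> XY_vars n" "keys m' \<subseteq> XY_vars n" by (auto simp: S_def)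
        have Y0: "lookup m (Yv j0) = lookup m' (Yv j0)"
          using le[of m m'] le[of m' m] m by simp
        have Y: "lookup m (Yv i) = lookup m' (Yv i)" if "i \<le> n" for i
          using at_Y[OF V(1) that] at_Y[OF V(2) that] m(3) Y0 by (auto split: if_splits)
        then have "T m = T m'" by (simp add: T_def)
        then have X: "lookup m (Xv i) = lookup m' (Xv i)" if "i \<le> n" for i
          using at_X[OF V(1) that] at_X[OF V(2) that] m(3) Y0 by (auto split: if_splits)
        show "m = m'"
        proof (rule poly_mapping_eqI)
          fix v show "lookup m v = lookup m' v"
          proof (cases "v \<in> XY_vars n")
            case True
            then show ?thesis using X Y by (auto simp: XY_vars_def)
          next
            case False
            then show ?thesis using V by (metis in_keys_iff subsetD)
          qed
        qed
      qed
    qed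
  next
    fix m assume m: "keys m \<subseteq> XY_vars n" "m \<notin> S"
    obtain r where "m = (xe a j0 + ye j0) + r"
      by (rule expo_le_split[of "xe a j0 + ye j0" m])
        (use m in \<open>auto simp: S_def lookup_add lookup_xe lookup_ye\<close>)
    moreover have "weight (\<lambda>v. of_nat (\<mu> v)) (xe a j + ye j) = (if j = j0 then 1 else 0)" for j
      by (simp add: xe_def ye_def \<mu>_def)
    ultimately show "\<exists>g\<in>{f}. \<exists>m0\<in>keys g. \<exists>r. m = m0 + r \<and>
        (\<forall>k\<in>keys g. weight w m0 \<le> weight w k) \<and>
        (\<forall>k\<in>keys g. k \<noteq> m0 \<longrightarrow> weight (\<lambda>v. of_nat (\<mu> v)) k < weight (\<lambda>v. of_nat (\<mu> v)) m0)"
      using j0 by (auto simp: keys_f weight_e simp del: weight_add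
          intro!: bexI[of _ "xe a j0 + ye j0"] exI[of _ r])
  qed
qed


section \<open>Planar orders and heights of an ultrametric\<close>

text \<open>The assumption on \<open>d\<close> is the ultrametric inequality for a valuation: large values mean that
  points are close.\<close>

lemma ultrametric_planar_order:
  fixes d :: "'a \<Rightarrow> 'a \<Rightarrow> 'r::linorder"
  assumes "finite S" and sym: "\<And>x y. d x y = d y x"
    and ultra: "\<And>x y z. x \<in> S \<Longrightarrow> y \<in> S \<Longrightarrow> z \<in> S \<Longrightarrow> x \<noteq> y \<Longrightarrow> y \<noteq> z \<Longrightarrow> x \<noteq> z \<Longrightarrow>
      min (d x y) (d y z) \<le> d x z"
  shows "\<exists>pos. bij_betw pos S {..<card S} \<and> (\<forall>x\<in>S. \<forall>y\<in>S. \<forall>z\<in>S.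
    pos x < pos y \<longrightarrow> pos y < pos z \<longrightarrow> d x z \<le> d x y \<and> d x z \<le> d y z)"
  using assms(1) ultra
proof (induction S rule: finite_induct)
  case empty
  show ?case by (intro exI[of _ "\<lambda>_. 0"]) (simp add: bij_betw_def)
next
  case (insert y S)
  then obtain pos where bij: "bij_betw pos S {..<card S}"
    and planar: "\<And>u v z. u \<in> S \<Longrightarrow> v \<in> S \<Longrightarrow> z \<in> S \<Longrightarrow> pos u < pos v \<Longrightarrow> pos v < pos z \<Longrightarrow>
      d u z \<le> d u v \<and> d u z \<le> d v z"
    by (metis insertCI)
  show ?case
  proof (cases "S = {}")
    case True
    then show ?thesis by (intro exI[of _ "\<lambda>_. 0"]) (auto simp: bij_betw_def)
  next
    case False
    define D where "D = Max (d y ` S)"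
    have D: "d y z \<le> D" if "z \<in> S" for z
      unfolding D_def using that insert.hyps(1) by simp
    have "D \<in> d y ` S"
      unfolding D_def by (rule Max_in) (use False insert.hyps(1) in auto)
    then have "{z \<in> S. d y z = D} \<noteq> {}" by auto
    then have "Max (pos ` {z \<in> S. d y z = D}) \<in> pos ` {z \<in> S. d y z = D}"
      using insert.hyps(1) by (intro Max_in) auto
    then obtain p where p: "p \<in> S" "d y p = D" "pos p = Max (pos ` {z \<in> S. d y z = D})"
      by auto
    have after_p: "d y z < D" if "z \<in> S" "pos p < pos z" for z
    proof (rule ccontr)
      assume "\<not> d y z < D"
      then have "z \<in> {z \<in> S. d y z = D}" using D[OF that(1)] that(1) by auto
      then have "pos z \<le> pos p" unfolding p(3) using insert.hyps(1) by (intro Max_ge) auto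
      then show False using that(2) by simp
    qed
    have dist_y: "d y z = min D (d p z)" if "z \<in> S" "z \<noteq> p" for z
    proof -
      have "min D (d p z) \<le> d y z" "min D (d y z) \<le> d p z"
        using insert.prems[of y p z] insert.prems[of p y z] that p(1,2) insert.hyps(2) sym[of p y]
        by auto
      then show ?thesis using D[OF that(1)] by (simp add: min_def split: if_splits)
    qed
    have pos_inj: "pos u = pos v \<longleftrightarrow> u = v" if "u \<in> S" "v \<in> S" for u v
      using bij that by (auto simp: bij_betw_def inj_on_eq_iff)
    have pos_less: "pos u < card S" if "u \<in> S" for u
      using bij that by (auto simp: bij_betw_def)
    \<comment> \<open>The new point goes right behind the last of its nearest points.\<close>
    define pos' where "pos' z = (if z = y then Suc (pos p) else if pos z \<le> pos p then pos z
      else Suc (pos z))" for z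
    have pos'_y: "pos' y = Suc (pos p)" by (simp add: pos'_def)
    have pos'_S: "pos' z = (if pos z \<le> pos p then pos z else Suc (pos z))" if "z \<in> S" for z
      using that insert.hyps(2) by (auto simp: pos'_def)
    have inj': "inj_on pos' (insert y S)"
      using insert.hyps(2) pos_inj by (auto simp: inj_on_def pos'_y pos'_S split: if_splits)
    moreover have "pos' ` insert y S = {..<card (insert y S)}"
    proof (rule card_subset_eq)
      show "pos' ` insert y S \<subseteq> {..<card (insert y S)}"
        using insert.hyps pos_less pos_less[OF p(1)] by (auto simp: pos'_y pos'_S less_Suc_eq)
      show "card (pos' ` insert y S) = card {..<card (insert y S)}"
        using card_image[OF inj'] by simp
    qed simp
    ultimately have "bij_betw pos' (insert y S) {..<card (insert y S)}"
      by (simp add: bij_betw_def)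
    moreover have "d u z \<le> d u v \<and> d u z \<le> d v z"
      if m: "u \<in> insert y S" "v \<in> insert y S" "z \<in> insert y S" and l: "pos' u < pos' v" "pos' v < pos' z"
      for u v z
    proof -
      consider "u \<in> S" "v \<in> S" "z \<in> S" | "u = y" "v \<in> S" "z \<in> S" | "u \<in> S" "v = y" "z \<in> S" |
        "u \<in> S" "v \<in> S" "z = y"
        using m l by auto
      then show ?thesis
      proof cases
        case 1
        then have "pos u < pos v" "pos v < pos z" using l by (auto simp: pos'_S split: if_splits)
        then show ?thesis using planar 1 by blast
      next
        case 2
        then have *: "pos p < pos v" "pos v < pos z" using l by (auto simp: pos'_S pos'_y split: if_splits)
        then have "d p z \<le> d p v \<and> d p z \<le> d v z" using planar p(1) 2 by blast
        moreover have "v \<noteq> p" "z \<noteq> p" using * by auto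
        ultimately show ?thesis using 2 * dist_y[of v] dist_y[of z] after_p[of z] by (auto simp: min_def)
      next
        case 3
        then have *: "pos u \<le> pos p" "pos p < pos z" using l by (auto simp: pos'_S pos'_y split: if_splits)
        have z: "d y z < D" "z \<noteq> p" using after_p 3 * by auto
        then have dz: "d p z = d y z" using dist_y[of z] 3 by (auto simp: min_def split: if_splits)
        show ?thesis
        proof (cases "u = p")
          case True
          then show ?thesis using 3 z dz p(2) sym[of p y] by simp
        next
          case False
          then have "pos u < pos p" using * pos_inj[of u p] 3 p(1) by auto
          then have "d u z \<le> d u p" "d u z \<le> d p z" using planar[of u p z] p(1) 3 * by auto
          then show ?thesis using 3 z dz dist_y[of u] False sym[of u p] sym[of u y] by auto
        qed
      next
        case 4
        then have *: "pos u < pos v" "pos v \<le> pos p" using l by (auto simp: pos'_S pos'_y split: if_splits)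
        then have u: "u \<noteq> p" by auto
        show ?thesis
        proof (cases "v = p")
          case True
          then show ?thesis
            using 4 dist_y[of u] u p(2) sym[of u p] sym[of u y] sym[of p y] by auto
        next
          case False
          then have "pos v < pos p" using * pos_inj[of v p] 4 p(1) by auto
          then have "d u p \<le> d u v \<and> d u p \<le> d v p" using planar p(1) 4 * by blast
          then show ?thesis
            using 4 dist_y[of u] dist_y[of v] u False sym[of u p] sym[of v p] sym[of u y] sym[of v y]
            by (auto simp: min_def)
        qed
      qed
    qed
    ultimately show ?thesis by blast
  qed
qed

text \<open>The height of the gap between the positions \<open>k - 1\<close> and \<open>k\<close> is the value of \<open>d\<close> on the two
  points there.\<close>

lemma planar_ultrametric_heights:
  fixes d :: "'a \<Rightarrow> 'a \<Rightarrow> 'r::linorder" and pos :: "'a \<Rightarrow> nat"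
  assumes bij: "bij_betw pos S {..<N}"
    and ultra: "\<And>x y z. x \<in> S \<Longrightarrow> y \<in> S \<Longrightarrow> z \<in> S \<Longrightarrow> x \<noteq> y \<Longrightarrow> y \<noteq> z \<Longrightarrow> x \<noteq> z \<Longrightarrow>
      min (d x y) (d y z) \<le> d x z"
    and planar: "\<And>x y z. x \<in> S \<Longrightarrow> y \<in> S \<Longrightarrow> z \<in> S \<Longrightarrow> pos x < pos y \<Longrightarrow> pos y < pos z \<Longrightarrow>
      d x z \<le> d x y \<and> d x z \<le> d y z"
  obtains h where "\<And>x y k. x \<in> S \<Longrightarrow> y \<in> S \<Longrightarrow> pos x < k \<Longrightarrow> k \<le> pos y \<Longrightarrow> d x y \<le> h k"
    and "\<And>x y. x \<in> S \<Longrightarrow> y \<in> S \<Longrightarrow> pos x < pos y \<Longrightarrow> \<exists>k. pos x < k \<and> k \<le> pos y \<and> d x y = h k"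
proof -
  define \<pi> where "\<pi> = inv_into S pos"
  have \<pi>: "\<pi> k \<in> S" "pos (\<pi> k) = k" if "k < N" for k
    using bij that by (auto simp: \<pi>_def bij_betw_def inv_into_into f_inv_into_f)
  have \<pi>_pos: "\<pi> (pos x) = x" if "x \<in> S" for x
    using bij that by (simp add: \<pi>_def bij_betw_def)
  have pos_N: "pos x < N" if "x \<in> S" for x
    using bij that by (auto simp: bij_betw_def)
  define h where "h k = d (\<pi> (k - 1)) (\<pi> k)" for k
  have main: "(\<forall>k. pos x < k \<longrightarrow> k \<le> pos y \<longrightarrow> d x y \<le> h k) \<and>
      (\<exists>k. pos x < k \<and> k \<le> pos y \<and> d x y = h k)" if "x \<in> S" "y \<in> S" "pos x < pos y" for x y
    using that
  proof (induction "pos y" arbitrary: y rule: less_induct)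
    case less
    define y' where "y' = \<pi> (pos y - 1)"
    have y': "y' \<in> S" "pos y' = pos y - 1"
      using \<pi>[of "pos y - 1"] pos_N[of y] less.prems by (auto simp: y'_def)
    have h_y: "h (pos y) = d y' y" using less.prems by (simp add: h_def y'_def \<pi>_pos)
    show ?case
    proof (cases "y' = x")
      case True
      have "d x y \<le> h k" if "pos x < k" "k \<le> pos y" for k
      proof -
        have "k = pos y" using y'(2) that True by simp
        then show ?thesis using h_y True by simp
      qed
      moreover have "d x y = h (pos y)" using h_y True by simp
      ultimately show ?thesis using less.prems(3) by blast
    next
      case False
      have "pos x \<noteq> pos y'"
        using False \<pi>_pos[of x] \<pi>_pos[of y'] less.prems(1) y'(1) by metis
      then have x_y': "pos x < pos y'" "pos y' < pos y" using y'(2) less.prems(3) by auto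
      then have IH: "\<And>k. pos x < k \<Longrightarrow> k \<le> pos y' \<Longrightarrow> d x y' \<le> h k"
        "\<exists>k. pos x < k \<and> k \<le> pos y' \<and> d x y' = h k"
        using less.hyps[of y'] y' less.prems by auto
      have le: "d x y \<le> d x y'" "d x y \<le> d y' y"
        using planar[of x y' y] x_y' less.prems y' by auto
      have "x \<noteq> y" "y' \<noteq> y" using x_y' by auto
      then have ge: "min (d x y') (d y' y) \<le> d x y"
        using ultra[of x y' y] less.prems y' False by auto
      have "d x y \<le> h k" if "pos x < k" "k \<le> pos y" for k
      proof (cases "k = pos y")
        case True
        then show ?thesis using h_y le by simp
      next
        case False
        then have "k \<le> pos y'" using that(2) y'(2) by simp
        then show ?thesis using IH(1)[of k] that(1) le(1) by simp
      qed
      moreover have "\<exists>k. pos x < k \<and> k \<le> pos y \<and> d x y = h k"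
      proof (cases "d x y' \<le> d y' y")
        case True
        then have "d x y = d x y'" using le ge by (simp add: min_def)
        then show ?thesis using IH(2) x_y' by (metis less_imp_le order.trans)
      next
        case False
        then have "d x y = h (pos y)" using le ge h_y by (simp add: min_def)
        then show ?thesis using less.prems(3) by blast
      qed
      ultimately show ?thesis by blast
    qed
  qed
  show thesis
  proof (rule that)
    show "d x y \<le> h k" if "x \<in> S" "y \<in> S" "pos x < k" "k \<le> pos y" for x y k
      using main[of x y] that by (meson less_le_trans)
    show "\<exists>k. pos x < k \<and> k \<le> pos y \<and> d x y = h k" if "x \<in> S" "y \<in> S" "pos x < pos y" for x y
      using main[of x y] that by blast
  qed
qed

section \<open>Noncrossing monomials\<close>

text \<open>The variable \<open>Z\<close> of an unordered pair of indices.\<close>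

definition zi :: "nat \<Rightarrow> nat \<Rightarrow> vars"
  where "zi i j = Zv (min i j) (max i j)"

lemma zi_commute: "zi i j = zi j i"
  by (simp add: zi_def min.commute max.commute)

lemma zi_eq_iff: "zi i j = zi k l \<longleftrightarrow> i = k \<and> j = l \<or> i = l \<and> j = k"
  by (auto simp: zi_def min_def max_def split: if_splits)

lemma XZ_vars_cases:
  fixes pos :: "nat \<Rightarrow> nat"
  assumes "v \<in> XZ_vars n" "inj_on pos {..n}"
  obtains i where "i \<le> n" "v = Xv i" | i j where "i \<le> n" "j \<le> n" "pos i < pos j" "v = zi i j"
proof -
  consider i where "i \<le> n" "v = Xv i" | j k where "v = Zv j k" "j < k" "k \<le> n"
    using assms(1) by (auto simp: XZ_vars_def)
  then show thesis
  proof cases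
    case 1
    then show ?thesis by (rule that(1))
  next
    case (2 j k)
    have "pos j \<noteq> pos k" using assms(2) 2 by (auto simp: inj_on_def)
    then consider "pos j < pos k" | "pos k < pos j" by linarith
    then show ?thesis
      using that(2)[of j k] that(2)[of k j] 2 by cases (auto simp: zi_def min_def max_def)
  qed
qed

lemma finite_XZ_vars: "finite (XZ_vars n)"
proof -
  have "XZ_vars n \<subseteq> Xv ` {..n} \<union> (\<lambda>(j, k). Zv j k) ` ({..n} \<times> {..n})"
    by (auto simp: XZ_vars_def image_iff)
  then show ?thesis by (rule finite_subset) auto
qed

text \<open>The indices \<open>0, \<dots>, n\<close> are placed on a line in an order \<open>pos\<close>, and a variable \<open>zi i j\<close> is viewed
  as a chord between \<open>i\<close> and \<open>j\<close>.  Each gap \<open>k\<close> between consecutive positions \<open>k - 1\<close> and \<open>k\<close> has a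
  rank \<open>\<rho> k\<close>, and \<open>\<kappa> i j\<close> is the gap of smallest rank below the chord.  No two gaps have the same
  rank.\<close>

locale planar_chords =
  fixes n :: nat and a :: "nat \<Rightarrow> nat" and pos :: "nat \<Rightarrow> nat"
    and \<kappa> :: "nat \<Rightarrow> nat \<Rightarrow> nat" and \<rho> :: "nat \<Rightarrow> 'r::linorder"
  assumes pos_inj: "inj_on pos {..n}"
    and \<rho>_inj: "inj \<rho>"
    and \<kappa>_commute: "\<kappa> i j = \<kappa> j i"
    and \<kappa>_between: "i \<le> n \<Longrightarrow> j \<le> n \<Longrightarrow> pos i < pos j \<Longrightarrow> pos i < \<kappa> i j \<and> \<kappa> i j \<le> pos j"
    and \<kappa>_min: "i \<le> n \<Longrightarrow> j \<le> n \<Longrightarrow> pos i < k \<Longrightarrow> k \<le> pos j \<Longrightarrow> \<rho> (\<kappa> i j) \<le> \<rho> k"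
begin

text \<open>In a noncrossing monomial no two chords cross, and no power \<open>x\<^sub>j\<^bsup>a\<^sub>j\<^esup>\<close> occurs below a chord.
  The second condition is noncrossing for chords from \<open>j\<close> to a point at infinity.\<close>

definition noncrossing :: "vars expo set"
  where "noncrossing = {m. keys m \<subseteq> XZ_vars n \<and>
    (\<forall>i j k. i \<le> n \<and> j \<le> n \<and> k \<le> n \<and> pos i < pos j \<and> pos j < pos k \<and> zi i k \<in> keys m \<longrightarrow>
      lookup m (Xv j) < a j) \<and>
    (\<forall>i j k l. i \<le> n \<and> j \<le> n \<and> k \<le> n \<and> l \<le> n \<and> pos i < pos j \<and> pos j < pos k \<and> pos k < pos l \<and>
      zi i k \<in> keys m \<longrightarrow> zi j l \<notin> keys m)}"

text \<open>The monomial substitution \<open>Z\<^sub>i\<^sub>j \<mapsto> x\<^sub>i\<^bsup>a\<^sub>i\<^esup> x\<^sub>j\<^bsup>a\<^sub>j\<^esup> s\<^sub>k\<close> with \<open>k = \<kappa> i j\<close>, where the variable \<open>s\<^sub>k\<close> is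
  represented by \<open>Yv k\<close>.  Its value at the variables \<open>Y\<close> is irrelevant.\<close>

definition lead_expo :: "vars \<Rightarrow> vars expo"
  where "lead_expo v = (case v of Xv i \<Rightarrow> single (Xv i) 1 | Yv i \<Rightarrow> 0
    | Zv i j \<Rightarrow> xe a i + xe a j + ye (\<kappa> i j))"

lemma lead_expo_simps:
  "lead_expo (Xv i) = single (Xv i) 1" "lead_expo (zi i j) = xe a i + xe a j + ye (\<kappa> i j)"
  by (auto simp: lead_expo_def zi_def min_def max_def \<kappa>_commute[of i j] add.commute)

lemma noncrossing_chordD:
  assumes "m \<in> noncrossing" "i \<le> n" "j \<le> n" "k \<le> n" "pos i < pos j" "pos j < pos k" "zi i k \<in> keys m"
  shows "lookup m (Xv j) < a j" "l \<le> n \<Longrightarrow> pos k < pos l \<Longrightarrow> zi j l \<notin> keys m"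
  using assms unfolding noncrossing_def by blast+

lemma chord_imp_at_X:
  assumes "zi i j \<in> keys m"
  shows "a i \<le> lookup (expo_subst lead_expo m) (Xv i)"
proof -
  have "1 * a i \<le> lookup m (zi i j) * lookup (lead_expo (zi i j)) (Xv i)"
    using assms by (intro mult_mono) (auto simp: lead_expo_simps lookup_add lookup_xe in_keys_iff)
  also have "\<dots> \<le> lookup (expo_subst lead_expo m) (Xv i)"
    unfolding lookup_expo_subst by (rule member_le_sum) (use assms in auto)
  finally show ?thesis by simp
qed

lemma no_chord_at_X:
  assumes "keys m \<subseteq> XZ_vars n" "\<And>j. j \<le> n \<Longrightarrow> zi i j \<notin> keys m"
  shows "lookup (expo_subst lead_expo m) (Xv i) = lookup m (Xv i)"
proof -
  have "lookup (expo_subst lead_expo m) (Xv i) = (\<Sum>v\<in>keys m. lookup m v when v = Xv i)"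
    unfolding lookup_expo_subst
  proof (rule sum.cong)
    fix v assume v: "v \<in> keys m"
    then have "v \<in> XZ_vars n" using assms(1) by blast
    then consider i where "i \<le> n" "v = Xv i" | i j where "i \<le> n" "j \<le> n" "pos i < pos j" "v = zi i j"
      by (rule XZ_vars_cases[OF _ pos_inj])
    then show "lookup m v * lookup (lead_expo v) (Xv i) = (lookup m v when v = Xv i)"
    proof cases
      case (1 j)
      then show ?thesis by (auto simp: lead_expo_simps lookup_single when_def)
    next
      case (2 j k)
      then have "j \<noteq> i" "k \<noteq> i" using assms(2) v zi_commute by metis+
      then show ?thesis using 2 by (simp add: lead_expo_simps lookup_add lookup_xe lookup_ye) (simp add: zi_def)
    qed
  qed simp
  then show ?thesis by (cases "Xv i \<in> keys m") (auto simp: when_def in_keys_iff)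
qed

lemma at_X_imp:
  assumes "keys m \<subseteq> XZ_vars n" "a i \<le> lookup (expo_subst lead_expo m) (Xv i)"
  shows "a i \<le> lookup m (Xv i) \<or> (\<exists>j\<le>n. zi i j \<in> keys m)"
  using no_chord_at_X[OF assms(1), of i] assms(2) by fastforce

lemma chord_imp_at_Y:
  assumes "zi i j \<in> keys m"
  shows "0 < lookup (expo_subst lead_expo m) (Yv (\<kappa> i j))"
proof -
  have "0 < lookup m (zi i j) * lookup (lead_expo (zi i j)) (Yv (\<kappa> i j))"
    using assms by (auto simp: lead_expo_simps lookup_add lookup_xe lookup_ye in_keys_iff)
  also have "\<dots> \<le> lookup (expo_subst lead_expo m) (Yv (\<kappa> i j))"
    unfolding lookup_expo_subst by (rule member_le_sum) (use assms in auto)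
  finally show ?thesis .
qed

lemma at_Y_imp:
  assumes "keys m \<subseteq> XZ_vars n" "0 < lookup (expo_subst lead_expo m) (Yv k)"
  obtains i j where "i \<le> n" "j \<le> n" "pos i < pos j" "zi i j \<in> keys m" "\<kappa> i j = k"
proof -
  have "(\<Sum>v\<in>keys m. lookup m v * lookup (lead_expo v) (Yv k)) \<noteq> 0"
    using assms(2) unfolding lookup_expo_subst by linarith
  then obtain v where v: "v \<in> keys m" "lookup m v * lookup (lead_expo v) (Yv k) \<noteq> 0"
    by (rule sum.not_neutral_contains_not_neutral)
  then have "v \<in> XZ_vars n" using assms(1) by blast
    then consider i where "i \<le> n" "v = Xv i" | i j where "i \<le> n" "j \<le> n" "pos i < pos j" "v = zi i j"
      by (rule XZ_vars_cases[OF _ pos_inj])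
    then show thesis
    proof cases
    case (1 i)
    then show ?thesis using v by (simp add: lead_expo_simps lookup_single)
  next
    case (2 i j)
    then show ?thesis
      using v that[of i j] by (auto simp: lead_expo_simps lookup_add lookup_xe lookup_ye split: if_splits)
  qed
qed

text \<open>From the image \<open>E\<close> of \<open>m\<close> one reads off the set \<open>H\<close> of the indices at which there is a chord or a
  power \<open>x\<^sub>i\<^bsup>a\<^sub>i\<^esup>\<close>, and the gaps that are used.  Let \<open>k\<close> be the used gap of highest rank.  Then the last
  element of \<open>H\<close> before the gap \<open>k\<close> and the first one behind it are joined by a chord of \<open>m\<close>.  The
  reason is that some chord uses \<open>k\<close>, every chord nested below it uses \<open>k\<close> as well, by maximality
  of \<open>k\<close>, and whatever is attached to the endpoints in question cannot cross it.\<close>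

lemma determined_chord:
  fixes m :: "vars expo"
  defines "E \<equiv> expo_subst lead_expo m"
  defines "H \<equiv> {i. i \<le> n \<and> a i \<le> lookup E (Xv i)}"
  assumes m: "m \<in> noncrossing"
    and k: "0 < lookup E (Yv k)" "\<And>k'. 0 < lookup E (Yv k') \<Longrightarrow> \<rho> k' \<le> \<rho> k"
    and g: "g \<in> H" "pos g < k" "\<And>i. i \<in> H \<Longrightarrow> pos i < k \<Longrightarrow> pos i \<le> pos g"
    and j: "j \<in> H" "k \<le> pos j" "\<And>i. i \<in> H \<Longrightarrow> k \<le> pos i \<Longrightarrow> pos j \<le> pos i"
  shows "zi g j \<in> keys m"
proof -
  have V: "keys m \<subseteq> XZ_vars n" using m by (simp add: noncrossing_def)
  have pos_eq: "u = v" if "u \<le> n" "v \<le> n" "pos u = pos v" for u v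
    using pos_inj that by (auto simp: inj_on_def)
  have chord_H: "u \<in> H" if "zi u v \<in> keys m" "u \<le> n" for u v
    using chord_imp_at_X[OF that(1)] that(2) by (simp add: H_def E_def)
  have H_chord: "a u \<le> lookup m (Xv u) \<or> (\<exists>v\<le>n. v \<noteq> u \<and> zi u v \<in> keys m)" if "u \<in> H" for u
  proof -
    have "zi u u \<notin> XZ_vars n" by (auto simp: XZ_vars_def zi_def)
    then show ?thesis using at_X_imp[OF V, of u] that V by (auto simp: H_def E_def)
  qed
  \<comment> \<open>A chord below a chord that uses \<open>k\<close> uses \<open>k\<close>, too.\<close>
  have nested: "\<kappa> u v = k"
    if "zi u v \<in> keys m" "u \<le> n" "v \<le> n" "p \<le> n" "q \<le> n" "\<kappa> p q = k"
      "pos p \<le> pos u" "pos u < pos v" "pos v \<le> pos q" for u v p q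
  proof -
    have "\<rho> (\<kappa> u v) \<le> \<rho> k" using k(2) chord_imp_at_Y[OF that(1)] by (simp add: E_def)
    moreover have "\<rho> k \<le> \<rho> (\<kappa> u v)"
      using \<kappa>_min[of p q "\<kappa> u v"] \<kappa>_between[of u v] that by auto
    ultimately show ?thesis using \<rho>_inj by (auto dest: injD)
  qed
  have gn: "g \<le> n" and jn: "j \<le> n" using g(1) j(1) by (auto simp: H_def)
  \<comment> \<open>Move the left end of a chord that uses \<open>k\<close> to \<open>g\<close>, then its right end to \<open>j\<close>.\<close>
  have "\<exists>q\<le>n. zi g q \<in> keys m \<and> \<kappa> g q = k \<and> pos g < pos q"
  proof -
    obtain p q where pq: "p \<le> n" "q \<le> n" "pos p < pos q" "zi p q \<in> keys m" "\<kappa> p q = k"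
      using at_Y_imp[OF V, of k] k(1) unfolding E_def by metis
    have k_pq: "pos p < k" "k \<le> pos q" using \<kappa>_between[of p q] pq by auto
    have "pos p \<le> pos g" using g(3)[of p] chord_H[of p q] pq k_pq by auto
    show ?thesis
    proof (cases "p = g")
      case True
      then show ?thesis using pq by blast
    next
      case False
      then have pg: "pos p < pos g" using \<open>pos p \<le> pos g\<close> pos_eq[of p g] pq(1) gn by fastforce
      have gq: "pos g < pos q" using g(2) k_pq by simp
      have "lookup m (Xv g) < a g"
        by (rule noncrossing_chordD(1)[OF m, of p g q]) (use pq gn pg gq in auto)
      then obtain l where l: "l \<le> n" "l \<noteq> g" "zi g l \<in> keys m" using H_chord[OF g(1)] by auto
      have "pos l \<noteq> pos g" using pos_eq[of l g] l gn by auto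
      then consider "pos l < pos p" | "pos p \<le> pos l" "pos l < pos g" | "pos g < pos l" "pos l \<le> pos q"
        | "pos q < pos l" by linarith
      then show ?thesis
      proof cases
        case 1
        then show ?thesis
          using noncrossing_chordD(2)[OF m, of l p g q] pq l gn pg gq by (auto simp: zi_commute[of l g])
      next
        case 2
        then have "\<kappa> l g = k" using nested[of l g p q] l pq gn gq by (simp add: zi_commute[of l g])
        then show ?thesis using \<kappa>_between[of l g] l gn 2 g(2) by auto
      next
        case 3
        then have "\<kappa> g l = k" using nested[of g l p q] l pq gn pg by simp
        then show ?thesis using l 3 by auto
      next
        case 4
        then show ?thesis
          using noncrossing_chordD(2)[OF m, of p g q l] pq l gn pg gq by auto
      qed
    qed
  qed
  then obtain q where q: "q \<le> n" "zi g q \<in> keys m" "\<kappa> g q = k" "pos g < pos q" by blast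
  have k_q: "k \<le> pos q" using \<kappa>_between[of g q] q gn by auto
  have "pos j \<le> pos q" using j(3)[of q] chord_H[of q g] q k_q by (auto simp: zi_commute[of q g])
  show ?thesis
  proof (cases "q = j")
    case True
    then show ?thesis using q by simp
  next
    case False
    then have jq: "pos j < pos q" using \<open>pos j \<le> pos q\<close> pos_eq[of j q] q(1) jn by fastforce
    have gj: "pos g < pos j" using g(2) j(2) by simp
    have "lookup m (Xv j) < a j"
      by (rule noncrossing_chordD(1)[OF m, of g j q]) (use q gn jn gj jq in auto)
    then obtain l where l: "l \<le> n" "l \<noteq> j" "zi j l \<in> keys m" using H_chord[OF j(1)] by auto
    have "pos l \<noteq> pos j" using pos_eq[of l j] l jn by auto
    then consider "pos l < pos g" | "pos g \<le> pos l" "pos l < pos j" | "pos j < pos l" "pos l \<le> pos q"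
      | "pos q < pos l" by linarith
    then show ?thesis
    proof cases
      case 1
      then show ?thesis
        using noncrossing_chordD(2)[OF m, of l g j q] q l gn jn gj jq by (auto simp: zi_commute[of l j])
    next
      case 2
      then have "\<kappa> l j = k" using nested[of l j g q] l q gn jn jq by (simp add: zi_commute[of l j])
      then have "pos l < k" using \<kappa>_between[of l j] l jn 2 by auto
      then have "pos l \<le> pos g" using g(3) chord_H[of l j] l by (simp add: zi_commute[of l j])
      then have "l = g" using pos_eq[of l g] 2 l gn by simp
      then show ?thesis using l by (simp add: zi_commute[of j g])
    next
      case 3
      then have "\<kappa> j l = k" using nested[of j l g q] l q gn jn gj by simp
      then show ?thesis using \<kappa>_between[of j l] l jn 3 j(2) by auto
    next
      case 4
      then show ?thesis
        using noncrossing_chordD(2)[OF m, of g j q l] q l gn jn gj jq by auto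
    qed
  qed
qed

lemma noncrossing_summand: "m + r \<in> noncrossing \<Longrightarrow> m \<in> noncrossing"
proof -
  assume mr: "m + r \<in> noncrossing"
  have keys: "v \<in> keys m \<Longrightarrow> v \<in> keys (m + r)" for v by (simp add: in_keys_iff lookup_add)
  have le: "lookup m v \<le> lookup (m + r) v" for v by (simp add: lookup_add)
  show ?thesis
    unfolding noncrossing_def
  proof (intro CollectI conjI allI impI; (elim conjE)?)
    show "keys m \<subseteq> XZ_vars n" using mr keys by (auto simp: noncrossing_def)
  next
    fix i j k
    assume "i \<le> n" "j \<le> n" "k \<le> n" "pos i < pos j" "pos j < pos k" "zi i k \<in> keys m"
    then have "lookup (m + r) (Xv j) < a j" using noncrossing_chordD(1)[OF mr] keys by blast
    then show "lookup m (Xv j) < a j" using le[of "Xv j"] by simp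
  next
    fix i j k l
    assume "i \<le> n" "j \<le> n" "k \<le> n" "l \<le> n" "pos i < pos j" "pos j < pos k" "pos k < pos l"
      "zi i k \<in> keys m"
    then show "zi j l \<notin> keys m" using noncrossing_chordD(2)[OF mr] keys by blast
  qed
qed

text \<open>Two noncrossing monomials with the same image have a chord in common, which can be
  cancelled.\<close>

lemma inj_on_noncrossing: "inj_on (expo_subst lead_expo) noncrossing"
proof (rule inj_onI)
  let ?E = "expo_subst lead_expo"
  fix m m' assume "m \<in> noncrossing" "m' \<in> noncrossing" "?E m = ?E m'"
  then show "m = m'"
  proof (induction "\<Sum>v\<in>XZ_vars n. lookup m v" arbitrary: m m' rule: less_induct)
    case less
    have V: "keys m \<subseteq> XZ_vars n" "keys m' \<subseteq> XZ_vars n"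
      using less.prems by (auto simp: noncrossing_def)
    define K where "K = {k. 0 < lookup (?E m) (Yv k)}"
    show ?case
    proof (cases "K = {}")
      case True
      have no_chord: "zi i j \<notin> keys m" "zi i j \<notin> keys m'" for i j
        using chord_imp_at_Y[of i j m] chord_imp_at_Y[of i j m'] True less.prems(3)
        by (auto simp: K_def)
      show ?thesis
      proof (rule poly_mapping_eqI)
        fix v
        show "lookup m v = lookup m' v"
        proof (cases "v \<in> XZ_vars n")
          case True
    then consider i where "i \<le> n" "v = Xv i" | i j where "i \<le> n" "j \<le> n" "pos i < pos j" "v = zi i j"
      by (rule XZ_vars_cases[OF _ pos_inj])
    then show ?thesis
    proof cases
            case (1 i)
            then show ?thesis
              using no_chord_at_X[OF V(1), of i] no_chord_at_X[OF V(2), of i] no_chord less.prems(3)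
              by simp
          next
            case (2 i j)
            then show ?thesis using no_chord[of i j] by (simp add: in_keys_iff)
          qed
        next
          case False
          then show ?thesis using V by (metis in_keys_iff subsetD)
        qed
      qed
    next
      case False
      have "finite K"
      proof (rule finite_subset)
        show "K \<subseteq> Yv -` keys (?E m)" by (auto simp: K_def in_keys_iff)
        show "finite (Yv -` keys (?E m))" by (rule finite_vimageI) (auto simp: inj_def)
      qed
      then have "Max (\<rho> ` K) \<in> \<rho> ` K" using False by (intro Max_in) auto
      then obtain k where "k \<in> K" "\<rho> k = Max (\<rho> ` K)" by auto
      then have k: "0 < lookup (?E m) (Yv k)" "\<And>k'. 0 < lookup (?E m) (Yv k') \<Longrightarrow> \<rho> k' \<le> \<rho> k"
        using \<open>finite K\<close> by (auto simp: K_def)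
      define H where "H = {i. i \<le> n \<and> a i \<le> lookup (?E m) (Xv i)}"
      have finH: "finite H" by (simp add: H_def)
      obtain p q where pq: "p \<le> n" "q \<le> n" "pos p < pos q" "zi p q \<in> keys m" "\<kappa> p q = k"
        using at_Y_imp[OF V(1) k(1)] by metis
      have "p \<in> H" "q \<in> H"
        using chord_imp_at_X[OF pq(4)] chord_imp_at_X[of q p m] pq by (auto simp: H_def zi_commute[of q p])
      moreover have "pos p < k" "k \<le> pos q" using \<kappa>_between[of p q] pq by auto
      ultimately have ne: "{i \<in> H. pos i < k} \<noteq> {}" "{i \<in> H. k \<le> pos i} \<noteq> {}" by auto
      have "Max (pos ` {i \<in> H. pos i < k}) \<in> pos ` {i \<in> H. pos i < k}"
        using ne(1) finH by (intro Max_in) auto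
      then obtain g where g0: "g \<in> H" "pos g < k" "pos g = Max (pos ` {i \<in> H. pos i < k})" by auto
      have g: "pos i \<le> pos g" if "i \<in> H" "pos i < k" for i
        unfolding g0(3) using that finH by (intro Max_ge) auto
      have "Min (pos ` {i \<in> H. k \<le> pos i}) \<in> pos ` {i \<in> H. k \<le> pos i}"
        using ne(2) finH by (intro Min_in) auto
      then obtain j where j0: "j \<in> H" "k \<le> pos j" "pos j = Min (pos ` {i \<in> H. k \<le> pos i})" by auto
      have j: "pos j \<le> pos i" if "i \<in> H" "k \<le> pos i" for i
        unfolding j0(3) using that finH by (intro Min_le) auto
      have "zi g j \<in> keys m"
        by (rule determined_chord[OF less.prems(1) k])
          (use g0 g j0 j in \<open>auto simp: H_def\<close>)
      have "zi g j \<in> keys m'"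
        by (rule determined_chord[OF less.prems(2) k[unfolded less.prems(3)]])
          (use g0 g j0 j in \<open>auto simp: H_def less.prems(3)\<close>)
      obtain r where "m = single (zi g j) 1 + r"
        by (rule expo_le_split[of "single (zi g j) 1" m])
          (use \<open>zi g j \<in> keys m\<close> in \<open>auto simp: lookup_single when_def in_keys_iff\<close>)
      obtain r' where "m' = single (zi g j) 1 + r'"
        by (rule expo_le_split[of "single (zi g j) 1" m'])
          (use \<open>zi g j \<in> keys m'\<close> in \<open>auto simp: lookup_single when_def in_keys_iff\<close>)
      with \<open>m = single (zi g j) 1 + r\<close> have r: "m = single (zi g j) 1 + r" "m' = single (zi g j) 1 + r'" by auto
      have nc: "r \<in> noncrossing" "r' \<in> noncrossing"
        using noncrossing_summand[of r "single (zi g j) 1"] noncrossing_summand[of r' "single (zi g j) 1"]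
          less.prems r by (auto simp: add.commute)
      have "?E r = ?E r'" using less.prems(3) by (simp add: r expo_subst_add)
      moreover have "(\<Sum>v\<in>XZ_vars n. lookup r v) < (\<Sum>v\<in>XZ_vars n. lookup m v)"
      proof (rule sum_strict_mono_ex1)
        show "\<exists>v\<in>XZ_vars n. lookup r v < lookup m v"
          using V(1) \<open>zi g j \<in> keys m\<close> by (intro bexI[of _ "zi g j"]) (auto simp: r lookup_add)
      qed (auto simp: finite_XZ_vars r lookup_add)
      ultimately show ?thesis using less.hyps[of r r'] nc r by simp
    qed
  qed
qed

end


section \<open>The Pluecker relations\<close>

text \<open>The exponent vector of the variable \<open>zi i j\<close>.\<close>

definition ze :: "nat \<Rightarrow> nat \<Rightarrow> vars expo"
  where "ze i j = single (zi i j) 1"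

lemma ze_commute: "ze i j = ze j i"
  by (simp add: ze_def zi_commute[of i j])

lemma lookup_ze: "lookup (ze i j) v = (if v = zi i j then 1 else 0)"
  by (auto simp: ze_def lookup_single when_def)

lemma zi_neq [simp]: "zi i j \<noteq> Xv k" "zi i j \<noteq> Yv k" "Xv k \<noteq> zi i j" "Yv k \<noteq> zi i j"
  by (simp_all add: zi_def)

lemma keys_trinomial:
  fixes b c :: complex
  assumes "m1 \<noteq> m2" "m1 \<noteq> m3" "m2 \<noteq> m3" "b \<noteq> 0" "c \<noteq> 0" "e \<noteq> 0"
  shows "keys (single m1 b + single m2 c + single m3 e) = {m1, m2, m3}"
  using assms by (auto simp: in_keys_iff lookup_add lookup_single when_def split: if_splits)

lemma distinct3_wlog:
  fixes P :: "nat \<Rightarrow> nat \<Rightarrow> nat \<Rightarrow> bool"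
  assumes sorted: "\<And>i j k. i < j \<Longrightarrow> j < k \<Longrightarrow> k \<le> n \<Longrightarrow> P i j k"
    and swap: "\<And>i j k. P i j k \<Longrightarrow> P j i k" "\<And>i j k. P i j k \<Longrightarrow> P i k j"
    and "i \<le> n" "j \<le> n" "k \<le> n" "i \<noteq> j" "i \<noteq> k" "j \<noteq> k"
  shows "P i j k"
proof -
  have two: "P i j k" if "i < j" "i \<le> n" "j \<le> n" "k \<le> n" "i \<noteq> k" "j \<noteq> k" for i j k
  proof -
    from that consider "j < k" | "i < k" "k < j" | "k < i" by linarith
    then show ?thesis
    proof cases
      case 1 then show ?thesis using sorted[of i j k] that by simp
    next
      case 2 then show ?thesis using swap(2)[OF sorted[of i k j]] that by simp
    next
      case 3 then show ?thesis using swap(2)[OF swap(1)[OF sorted[of k i j]]] that by simp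
    qed
  qed
  from assms consider "i < j" | "j < i" by linarith
  then show ?thesis
    by cases (use two[of i j k] swap(1)[OF two[of j i k]] assms(4-) in simp_all)
qed

lemma distinct4_wlog:
  fixes P :: "nat \<Rightarrow> nat \<Rightarrow> nat \<Rightarrow> nat \<Rightarrow> bool"
  assumes sorted: "\<And>i j k l. i < j \<Longrightarrow> j < k \<Longrightarrow> k < l \<Longrightarrow> l \<le> n \<Longrightarrow> P i j k l"
    and swap: "\<And>i j k l. P i j k l \<Longrightarrow> P j i k l" "\<And>i j k l. P i j k l \<Longrightarrow> P i k j l"
      "\<And>i j k l. P i j k l \<Longrightarrow> P i j l k"
    and bounds: "i \<le> n" "j \<le> n" "k \<le> n" "l \<le> n" and neq: "i \<noteq> j" "i \<noteq> k" "j \<noteq> k" "i \<noteq> l" "j \<noteq> l" "k \<noteq> l"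
  shows "P i j k l"
proof -
  have "\<forall>l\<le>n. l \<noteq> i \<longrightarrow> l \<noteq> j \<longrightarrow> l \<noteq> k \<longrightarrow> P i j k l"
  proof (rule distinct3_wlog[of n "\<lambda>i j k. \<forall>l\<le>n. l \<noteq> i \<longrightarrow> l \<noteq> j \<longrightarrow> l \<noteq> k \<longrightarrow> P i j k l"])
    fix i j k assume ijk: "i < j" "j < k" "k \<le> n"
    show "\<forall>l\<le>n. l \<noteq> i \<longrightarrow> l \<noteq> j \<longrightarrow> l \<noteq> k \<longrightarrow> P i j k l"
    proof (intro allI impI)
      fix l assume "l \<le> n" "l \<noteq> i" "l \<noteq> j" "l \<noteq> k"
      then consider "k < l" | "j < l" "l < k" | "i < l" "l < j" | "l < i" by linarith
      then show "P i j k l"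
      proof cases
        case 1 then show ?thesis using sorted[of i j k l] ijk \<open>l \<le> n\<close> by simp
      next
        case 2 then show ?thesis using swap(3)[OF sorted[of i j l k]] ijk by simp
      next
        case 3 then show ?thesis using swap(3)[OF swap(2)[OF sorted[of i l j k]]] ijk by simp
      next
        case 4 then show ?thesis using swap(3)[OF swap(2)[OF swap(1)[OF sorted[of l i j k]]]] ijk by simp
      qed
    qed
  next
    fix i j k assume P: "\<forall>l\<le>n. l \<noteq> i \<longrightarrow> l \<noteq> j \<longrightarrow> l \<noteq> k \<longrightarrow> P i j k l"
    show "\<forall>l\<le>n. l \<noteq> j \<longrightarrow> l \<noteq> i \<longrightarrow> l \<noteq> k \<longrightarrow> P j i k l"
      by (intro allI impI, rule swap(1)) (use P in simp)
    show "\<forall>l\<le>n. l \<noteq> i \<longrightarrow> l \<noteq> k \<longrightarrow> l \<noteq> j \<longrightarrow> P i k j l"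
      by (intro allI impI, rule swap(2)) (use P in simp)
  qed (use bounds neq in auto)
  then show ?thesis using bounds neq by simp
qed

text \<open>The sets of terms of the generators do not depend on the order of the indices, so they can be
  stated for distinct indices; the signs of the coefficients play no role in the rewriting.\<close>

lemma linear_relation:
  assumes "i \<le> n" "j \<le> n" "k \<le> n" "i \<noteq> j" "i \<noteq> k" "j \<noteq> k"
  shows "\<exists>g\<in>dual_gens n a. keys g = {xe a i + ze j k, xe a j + ze i k, xe a k + ze i j}"
proof (rule distinct3_wlog[where P = "\<lambda>i j k. \<exists>g\<in>dual_gens n a.
    keys g = {xe a i + ze j k, xe a j + ze i k, xe a k + ze i j}"])
  fix i j k :: nat assume ijk: "i < j" "j < k" "k \<le> n"
  define g where "g = xv j ^ a j * zv i k - xv k ^ a k * zv i j - xv i ^ a i * zv j k"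
  have g: "g = single (xe a j + ze i k) 1 + single (xe a k + ze i j) (- 1) + single (xe a i + ze j k) (- 1)"
    unfolding g_def var_power using ijk
    by (simp add: var_def monomial_def mult_single xe_def ze_def zi_def single_uminus)
  have "lookup (xe a j + ze i k) (zi i k) = 1" "lookup (xe a k + ze i j) (zi i k) = 0"
    "lookup (xe a i + ze j k) (zi i k) = 0"
    "lookup (xe a k + ze i j) (zi i j) = 1" "lookup (xe a i + ze j k) (zi i j) = 0"
    using ijk by (auto simp: lookup_add lookup_xe lookup_ze zi_eq_iff)
  then have "xe a j + ze i k \<noteq> xe a k + ze i j" "xe a j + ze i k \<noteq> xe a i + ze j k"
    "xe a k + ze i j \<noteq> xe a i + ze j k" by (metis zero_neq_one)+
  then have "keys g = {xe a j + ze i k, xe a k + ze i j, xe a i + ze j k}"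
    unfolding g by (intro keys_trinomial) simp_all
  moreover have "g \<in> dual_gens n a"
    unfolding dual_gens_def g_def by (intro UnI1 CollectI exI conjI) (rule refl | fact ijk)+
  ultimately show "\<exists>g\<in>dual_gens n a. keys g = {xe a i + ze j k, xe a j + ze i k, xe a k + ze i j}"
    by (intro bexI[of _ g]) (simp_all add: insert_commute)
next
  fix i j k
  assume "\<exists>g\<in>dual_gens n a. keys g = {xe a i + ze j k, xe a j + ze i k, xe a k + ze i j}"
  then show "\<exists>g\<in>dual_gens n a. keys g = {xe a j + ze i k, xe a i + ze j k, xe a k + ze j i}"
    by (simp add: insert_commute ze_commute[of i j])
next
  fix i j k
  assume "\<exists>g\<in>dual_gens n a. keys g = {xe a i + ze j k, xe a j + ze i k, xe a k + ze i j}"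
  then show "\<exists>g\<in>dual_gens n a. keys g = {xe a i + ze k j, xe a k + ze i j, xe a j + ze i k}"
    by (simp add: insert_commute ze_commute[of j k])
qed (use assms in auto)

lemma quadratic_relation:
  assumes "i \<le> n" "j \<le> n" "k \<le> n" "l \<le> n" "i \<noteq> j" "i \<noteq> k" "j \<noteq> k" "i \<noteq> l" "j \<noteq> l" "k \<noteq> l"
  shows "\<exists>g\<in>dual_gens n a. keys g = {ze i j + ze k l, ze i k + ze j l, ze i l + ze j k}"
proof (rule distinct4_wlog[where P = "\<lambda>i j k l. \<exists>g\<in>dual_gens n a.
    keys g = {ze i j + ze k l, ze i k + ze j l, ze i l + ze j k}"])
  fix i j k l :: nat assume ijkl: "i < j" "j < k" "k < l" "l \<le> n"
  define g where "g = zv i j * zv k l - zv i k * zv j l + zv i l * zv j k"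
  have g: "g = single (ze i j + ze k l) 1 + single (ze i k + ze j l) (- 1) + single (ze i l + ze j k) 1"
    unfolding g_def using ijkl
    by (simp add: var_def monomial_def mult_single ze_def zi_def single_uminus)
  have "lookup (ze i j + ze k l) (zi i j) = 1" "lookup (ze i k + ze j l) (zi i j) = 0"
    "lookup (ze i l + ze j k) (zi i j) = 0"
    "lookup (ze i k + ze j l) (zi i k) = 1" "lookup (ze i l + ze j k) (zi i k) = 0"
    using ijkl by (auto simp: lookup_add lookup_ze zi_eq_iff)
  then have "ze i j + ze k l \<noteq> ze i k + ze j l" "ze i j + ze k l \<noteq> ze i l + ze j k"
    "ze i k + ze j l \<noteq> ze i l + ze j k" by (metis zero_neq_one)+
  then have "keys g = {ze i j + ze k l, ze i k + ze j l, ze i l + ze j k}"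
    unfolding g by (intro keys_trinomial) simp_all
  moreover have "g \<in> dual_gens n a"
    unfolding dual_gens_def g_def by (intro UnI2 CollectI exI conjI) (rule refl | fact ijkl)+
  ultimately show "\<exists>g\<in>dual_gens n a. keys g = {ze i j + ze k l, ze i k + ze j l, ze i l + ze j k}"
    by (intro bexI[of _ g])
next
  fix i j k l
  assume "\<exists>g\<in>dual_gens n a. keys g = {ze i j + ze k l, ze i k + ze j l, ze i l + ze j k}"
  then show "\<exists>g\<in>dual_gens n a. keys g = {ze j i + ze k l, ze j k + ze i l, ze j l + ze i k}"
    by (simp add: insert_commute ze_commute[of i j] add.commute)
next
  fix i j k l
  assume "\<exists>g\<in>dual_gens n a. keys g = {ze i j + ze k l, ze i k + ze j l, ze i l + ze j k}"
  then show "\<exists>g\<in>dual_gens n a. keys g = {ze i k + ze j l, ze i j + ze k l, ze i l + ze k j}"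
    by (simp add: insert_commute ze_commute[of j k])
next
  fix i j k l
  assume "\<exists>g\<in>dual_gens n a. keys g = {ze i j + ze k l, ze i k + ze j l, ze i l + ze j k}"
  then show "\<exists>g\<in>dual_gens n a. keys g = {ze i j + ze l k, ze i l + ze j k, ze i k + ze j l}"
    by (simp add: insert_commute ze_commute[of k l])
qed (use assms in auto)


section \<open>The dual ideals\<close>

lemma well_poised_I_dual_ideal: "well_poised (XZ_vars n) (I_dual_ideal n a)"
  unfolding well_poised_def
proof (intro conjI ballI)
  let ?V = "XZ_vars n"
  have GV: "dual_gens n a \<subseteq> polys_in ?V"
    using dual_gens_in_carrier[of n a] by (simp add: carrier_poly_ring)
  show I: "ideal (I_dual_ideal n a) (poly_ring ?V)"
    unfolding I_dual_ideal_def by (rule ideal_genideal[OF GV])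
  have G_in: "g \<in> I_dual_ideal n a" if "g \<in> dual_gens n a" for g
    using ring.genideal_self[OF ring_poly_ring, of "dual_gens n a" ?V] GV that
    by (auto simp: I_dual_ideal_def carrier_poly_ring)
  fix w assume w: "w \<in> trop ?V (I_dual_ideal n a)"
  define A where "A i = of_nat (a i) * w (Xv i)" for i
  define d where "d i j = w (zi i j) - A i - A j" for i j
  have d_commute: "d i j = d j i" for i j by (simp add: d_def zi_commute[of i j])
  have weight_xe: "weight w (xe a i) = A i" for i by (simp add: xe_def A_def)
  have weight_ze: "weight w (ze i j) = A i + A j + d i j" for i j by (simp add: ze_def d_def)
  \<comment> \<open>The terms of a linear relation have weights \<open>A i + A j + A k\<close> plus \<open>d j k\<close>, \<open>d i k\<close>, \<open>d i j\<close>.\<close>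
  have ultra: "min (d i j) (d j k) \<le> d i k"
    if ijk: "i \<in> {..n}" "j \<in> {..n}" "k \<in> {..n}" "i \<noteq> j" "j \<noteq> k" "i \<noteq> k" for i j k
  proof -
    obtain g where g: "g \<in> dual_gens n a" "keys g = {xe a i + ze j k, xe a j + ze i k, xe a k + ze i j}"
      using linear_relation[of i n j k a] ijk unfolding atMost_iff by blast
    obtain m where m: "m \<in> keys g" "m \<noteq> xe a j + ze i k" "weight w m \<le> weight w (xe a j + ze i k)"
      using trop_not_strict_min[OF I w G_in[OF g(1)], of "xe a j + ze i k"] unfolding g(2) by blast
    then have "m = xe a i + ze j k \<or> m = xe a k + ze i j" unfolding g(2) by blast
    then show ?thesis
      using m(3) by (elim disjE) (simp_all add: weight_xe weight_ze min_le_iff_disj)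
  qed
  obtain pos where bij: "bij_betw pos {..n} {..<Suc n}"
    and planar: "\<And>i j k. i \<in> {..n} \<Longrightarrow> j \<in> {..n} \<Longrightarrow> k \<in> {..n} \<Longrightarrow> pos i < pos j \<Longrightarrow> pos j < pos k \<Longrightarrow>
      d i k \<le> d i j \<and> d i k \<le> d j k"
    using ultrametric_planar_order[of "{..n}" d] d_commute ultra by (auto simp: Ball_def)
  obtain h where h_ge: "\<And>i j k. i \<in> {..n} \<Longrightarrow> j \<in> {..n} \<Longrightarrow> pos i < k \<Longrightarrow> k \<le> pos j \<Longrightarrow> d i j \<le> h k"
    and h_eq: "\<And>i j. i \<in> {..n} \<Longrightarrow> j \<in> {..n} \<Longrightarrow> pos i < pos j \<Longrightarrow> \<exists>k. pos i < k \<and> k \<le> pos j \<and> d i j = h k"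
    by (rule planar_ultrametric_heights[where d = d, OF bij]) ((rule ultra planar that; assumption)+)
  define B where "B i j = {min (pos i) (pos j)<..max (pos i) (pos j)}" for i j
  \<comment> \<open>Gaps are ranked lexicographically by height and position.\<close>
  define \<rho> where "\<rho> k = (h k, k)" for k :: nat
  define \<kappa> where "\<kappa> i j = arg_min_on \<rho> (B i j)" for i j
  have pos_neq: "pos i \<noteq> pos j" if "i \<le> n" "j \<le> n" "i \<noteq> j" for i j
    using bij that by (auto simp: bij_betw_def inj_on_eq_iff)
  have pos_le: "pos i \<le> n" if "i \<le> n" for i
  proof -
    have "pos i \<in> {..<Suc n}" using bij that unfolding bij_betw_def by blast
    then show ?thesis by simp
  qed
  have B_commute: "B i j = B j i" for i j by (simp add: B_def min.commute max.commute)
  have B_less: "B i j = {pos i<..pos j}" if "pos i < pos j" for i j using that by (simp add: B_def)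
  have \<kappa>: "\<kappa> i j \<in> B i j" "\<And>k. k \<in> B i j \<Longrightarrow> \<rho> (\<kappa> i j) \<le> \<rho> k" if "pos i \<noteq> pos j" for i j
  proof -
    have "finite (B i j)" "B i j \<noteq> {}" using that by (auto simp: B_def)
    note * = arg_min_if_finite[OF this, of \<rho>]
    show "\<kappa> i j \<in> B i j" unfolding \<kappa>_def by (rule *(1))
    show "\<rho> (\<kappa> i j) \<le> \<rho> k" if "k \<in> B i j" for k
      unfolding \<kappa>_def using *(2) that not_less by blast
  qed
  have h_\<kappa>: "h (\<kappa> i j) = d i j" if "i \<le> n" "j \<le> n" "i \<noteq> j" for i j
  proof -
    have *: "h (\<kappa> i j) = d i j" if ij: "i \<le> n" "j \<le> n" "pos i < pos j" for i j
    proof (rule order.antisym)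
      obtain k where k: "pos i < k" "k \<le> pos j" "d i j = h k" using h_eq[of i j] ij unfolding atMost_iff by blast
      have "k \<in> B i j" using k ij(3) by (simp add: B_less)
      then have "\<rho> (\<kappa> i j) \<le> \<rho> k" using ij(3) by (intro \<kappa>(2)) simp_all
      then show "h (\<kappa> i j) \<le> d i j" using k(3) by (auto simp: \<rho>_def)
      have "\<kappa> i j \<in> {pos i<..pos j}" using \<kappa>(1)[of i j] ij(3) by (simp add: B_less)
      then show "d i j \<le> h (\<kappa> i j)" using ij by (intro h_ge) simp_all
    qed
    have "\<kappa> i j = \<kappa> j i" by (simp add: \<kappa>_def B_commute)
    then have "h (\<kappa> i j) = d i j" if "pos j < pos i"
      using *[of j i] \<open>i \<le> n\<close> \<open>j \<le> n\<close> that d_commute[of i j] by simp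
    then show ?thesis using *[of i j] that pos_neq[OF that] by linarith
  qed
  interpret planar_chords n a pos \<kappa> \<rho>
  proof
    show "inj_on pos {..n}" using bij by (simp add: bij_betw_def)
    show "inj \<rho>" by (simp add: \<rho>_def inj_def)
    show "\<kappa> i j = \<kappa> j i" for i j by (simp add: \<kappa>_def B_commute)
    show "pos i < \<kappa> i j \<and> \<kappa> i j \<le> pos j" if "i \<le> n" "j \<le> n" "pos i < pos j" for i j
      using \<kappa>(1)[of i j] that by (auto simp: B_less)
    show "\<rho> (\<kappa> i j) \<le> \<rho> k" if "i \<le> n" "j \<le> n" "pos i < k" "k \<le> pos j" for i j k
      using \<kappa>(2)[of i j k] that by (auto simp: B_less)
  qed
  define \<sigma> :: "vars \<Rightarrow> vars cpoly" where "\<sigma> v = (case v of Xv i \<Rightarrow> single (single (Xv i) 1) 1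
    | Yv i \<Rightarrow> 0
    | Zv i j \<Rightarrow> \<Sum>k\<in>B i j. single (xe a i + xe a j + ye k) (if pos i < pos j then 1 else - 1))" for v
  define w' where "w' v = (case v of Xv i \<Rightarrow> w (Xv i) | Yv k \<Rightarrow> h k | Zv i j \<Rightarrow> 0)" for v
  define t :: "vars \<Rightarrow> rat" where "t v = (case v of Yv k \<Rightarrow> of_nat k | _ \<Rightarrow> 0)" for v
  \<comment> \<open>Any function that is strictly increasing on \<open>{0..n}\<close> and strictly concave would do as weight of
    a chord of length \<open>l\<close>: uncrossing two chords then lowers the total weight, and so does replacing
    a chord by a shorter one.\<close>
  define f where "f l = l * (2 * n + 1 - l)" for l :: nat
  define \<mu> :: "vars \<Rightarrow> nat"
    where "\<mu> v = (case v of Zv i j \<Rightarrow> f (max (pos i) (pos j) - min (pos i) (pos j)) | _ \<Rightarrow> 0)" for v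
  \<comment> \<open>\<open>R (pos i)\<close> is the parameter \<open>r\<^sub>i\<close> of the parametrization.\<close>
  define R where "R p = (\<Sum>k\<in>{0<..p}. yv k)" for p
  have R_diff: "(\<Sum>k\<in>{p<..q}. yv k) = R q - R p" if "p \<le> q" for p q
  proof -
    have "{0<..q} = {0<..p} \<union> {p<..q}" using that by auto
    then have "R q = R p + (\<Sum>k\<in>{p<..q}. yv k)" unfolding R_def by (simp add: sum.union_disjoint)
    then show ?thesis by simp
  qed
  have \<sigma>_Z: "\<sigma> (Zv i j) = xv i ^ a i * xv j ^ a j * (R (pos j) - R (pos i))" for i j
  proof -
    have "\<sigma> (Zv i j) = (\<Sum>k\<in>B i j. xv i ^ a i * xv j ^ a j * (yv k * (if pos i < pos j then 1 else - 1)))"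
      unfolding \<sigma>_def vars.case
      by (rule sum.cong) (simp_all add: var_power mult_single xe_def,
        simp_all add: var_def monomial_def mult_single ye_def single_uminus)
    also have "\<dots> = xv i ^ a i * xv j ^ a j * ((\<Sum>k\<in>B i j. yv k) * (if pos i < pos j then 1 else - 1))"
      by (simp add: sum_distrib_left sum_distrib_right)
    also have "(\<Sum>k\<in>B i j. yv k) * (if pos i < pos j then 1 else - 1) = R (pos j) - R (pos i)"
      using R_diff[of "pos i" "pos j"] R_diff[of "pos j" "pos i"] by (auto simp: B_def)
    finally show ?thesis .
  qed
  have \<sigma>_X: "\<sigma> (Xv i) = xv i" for i by (simp add: \<sigma>_def var_def monomial_def)
  have keys_Z: "keys (\<sigma> (Zv i j)) = (\<lambda>k. xe a i + xe a j + ye k) ` B i j" for i j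
    unfolding \<sigma>_def vars.case
  proof (rule keys_sum_singles)
    show "inj_on (\<lambda>k. xe a i + xe a j + ye k) (B i j)"
    proof (rule inj_onI)
      fix k l assume "xe a i + xe a j + ye k = xe a i + xe a j + ye l"
      then have "lookup (ye k) (Yv k) = lookup (ye l) (Yv k)" by simp
      then show "k = l" by (simp add: lookup_ye split: if_splits)
    qed
  qed (auto simp: B_def)
  have weight_Z: "weight w' (xe a i + xe a j + ye k) = A i + A j + h k"
    "weight t (xe a i + xe a j + ye k) = of_nat k" for i j k
    by (simp_all add: xe_def ye_def w'_def t_def A_def)
  have lead_Z: "lead_expo (Zv i j) = xe a i + xe a j + ye (\<kappa> i j)" for i j
    by (simp add: lead_expo_def)
  show "primeideal (initial_ideal ?V w (I_dual_ideal n a)) (poly_ring ?V)"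
    unfolding I_dual_ideal_def
  proof (rule initial_ideal_primeI[OF GV, where \<sigma> = \<sigma> and \<psi> = lead_expo and w' = w' and t = t
        and S = noncrossing and \<mu> = \<mu>])
    fix g assume "g \<in> dual_gens n a"
    then show "subst \<sigma> g = 0"
      unfolding dual_gens_def
      by (auto simp: subst_add subst_diff subst_mult subst_power \<sigma>_Z \<sigma>_X) (auto simp: algebra_simps)
  next
    fix v assume "v \<in> ?V"
    then consider (X) i where "v = Xv i" | (Z) i j where "v = Zv i j" "i < j" "j \<le> n"
      by (auto simp: XZ_vars_def)
    note v = this
    show "lead_expo v \<in> keys (\<sigma> v)"
      using v
    proof cases
      case X
      then show ?thesis by (simp add: \<sigma>_def lead_expo_simps)
    next
      case Z
      then show ?thesis using \<kappa>(1)[OF pos_neq, of i j] by (simp add: keys_Z lead_Z)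
    qed
    show wt: "weight w' (lead_expo v) = w v"
      using v
    proof cases
      case X
      then show ?thesis by (simp add: w'_def lead_expo_simps)
    next
      case Z
      then have "zi i j = Zv i j" by (simp add: zi_def)
      then show ?thesis using Z h_\<kappa>[of i j] unfolding Z lead_Z weight_Z by (simp add: d_def)
    qed
    fix m assume m: "m \<in> keys (\<sigma> v)" "m \<noteq> lead_expo v"
    show "w v < weight w' m \<or> w v = weight w' m \<and> weight t (lead_expo v) < weight t m"
      using v
    proof cases
      case X
      then show ?thesis using m by (simp add: \<sigma>_def lead_expo_simps)
    next
      case Z
      then obtain k where k: "k \<in> B i j" "m = xe a i + xe a j + ye k" using m(1) by (auto simp: keys_Z)
      then have "k \<noteq> \<kappa> i j" using m(2) by (auto simp: Z lead_Z)
      moreover have "\<rho> (\<kappa> i j) \<le> \<rho> k" using \<kappa>(2)[OF pos_neq k(1)] Z by simp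
      ultimately have "h (\<kappa> i j) < h k \<or> h (\<kappa> i j) = h k \<and> \<kappa> i j < k" by (auto simp: \<rho>_def)
      moreover note wt[symmetric]
      ultimately show ?thesis unfolding Z lead_Z k weight_Z by auto
    qed
  next
    show "inj_on (expo_subst lead_expo) noncrossing" by (rule inj_on_noncrossing)
  next
    have \<mu>_Z: "\<mu> (zi i j) = f (max (pos i) (pos j) - min (pos i) (pos j))" for i j
      by (auto simp: \<mu>_def zi_def min_def max_def)
    have N_xe: "weight (\<lambda>v. of_nat (\<mu> v)) (xe a i) = 0" for i
      by (simp add: xe_def \<mu>_def)
    have N_ze: "weight (\<lambda>v. of_nat (\<mu> v)) (ze i j) = of_nat (\<mu> (zi i j))" for i j
      by (simp add: ze_def)
    have f_less: "f p < f q" if "p < q" "q \<le> n" for p q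
    proof -
      define e where "e = q - p"
      define c where "c = 2 * n + 1 - q"
      have *: "q = p + e" "2 * n + 1 - q = c" "2 * n + 1 - p = c + e" "p < c" "0 < e"
        using that by (auto simp: e_def c_def)
      have "f q = p * c + e * c" "f p = p * c + e * p"
        unfolding f_def *(2,3) by (simp_all add: *(1) algebra_simps)
      then show ?thesis using *(4,5) by simp
    qed
    have f_cross: "f b + f (p + b + q) < f (p + b) + f (b + q)" "f p + f q < f (p + b) + f (b + q)"
      if "0 < p" "0 < b" "0 < q" "p + b + q \<le> n" for p b q
    proof -
      define c where "c = 2 * n + 1 - (p + b + q)"
      have c: "0 < c" "2 * n + 1 - p = c + b + q" "2 * n + 1 - b = c + p + q" "2 * n + 1 - q = c + p + b"
        "2 * n + 1 - (p + b) = c + q" "2 * n + 1 - (b + q) = c + p" "2 * n + 1 - (p + b + q) = c"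
        using that by (auto simp: c_def)
      have "f (p + b) + f (b + q) = f b + f (p + b + q) + 2 * (p * q)"
        "f (p + b) + f (b + q) = f p + f q + 2 * (b * c)"
        unfolding f_def c(2-7) by (simp_all add: algebra_simps)
      moreover have "0 < p * q" "0 < b * c" using that c(1) by auto
      ultimately show "f b + f (p + b + q) < f (p + b) + f (b + q)" "f p + f q < f (p + b) + f (b + q)"
        by linarith+
    qed
    fix m assume m: "keys m \<subseteq> ?V" "m \<notin> noncrossing"
    consider (lin) i j k where "i \<le> n" "j \<le> n" "k \<le> n" "pos i < pos j" "pos j < pos k"
        "zi i k \<in> keys m" "a j \<le> lookup m (Xv j)"
      | (quad) i j k l where "i \<le> n" "j \<le> n" "k \<le> n" "l \<le> n" "pos i < pos j" "pos j < pos k"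
        "pos k < pos l" "zi i k \<in> keys m" "zi j l \<in> keys m"
      using m unfolding noncrossing_def by (auto simp: not_less)
    then show "\<exists>g\<in>dual_gens n a. \<exists>m0\<in>keys g. \<exists>r. m = m0 + r \<and>
        (\<forall>k\<in>keys g. weight w m0 \<le> weight w k) \<and>
        (\<forall>k\<in>keys g. k \<noteq> m0 \<longrightarrow> weight (\<lambda>v. of_nat (\<mu> v)) k < weight (\<lambda>v. of_nat (\<mu> v)) m0)"
    proof cases
      case lin
      obtain r where r: "m = (xe a j + ze i k) + r"
      proof (rule expo_le_split[of "xe a j + ze i k" m])
        show "lookup (xe a j + ze i k) v \<le> lookup m v" for v
          using lin by (auto simp: lookup_add lookup_xe lookup_ze in_keys_iff)
      qed
      obtain g where g: "g \<in> dual_gens n a" "keys g = {xe a i + ze j k, xe a j + ze i k, xe a k + ze i j}"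
        using linear_relation[of i n j k a] lin by fastforce
      have "d i k \<le> d i j" "d i k \<le> d j k" using planar[of i j k] lin by auto
      moreover have "\<mu> (zi j k) < \<mu> (zi i k)" "\<mu> (zi i j) < \<mu> (zi i k)"
        using lin pos_le[of k] by (auto simp: \<mu>_Z intro!: f_less)
      ultimately show ?thesis
        using g r by (intro bexI[of _ g] bexI[of _ "xe a j + ze i k"] exI[of _ r])
          (auto simp: weight_xe weight_ze N_xe N_ze)
    next
      case quad
      have "zi i k \<noteq> zi j l" using quad by (auto simp: zi_eq_iff)
      obtain r where r: "m = (ze i k + ze j l) + r"
      proof (rule expo_le_split[of "ze i k + ze j l" m])
        show "lookup (ze i k + ze j l) v \<le> lookup m v" for v
          using quad \<open>zi i k \<noteq> zi j l\<close> by (auto simp: lookup_add lookup_ze in_keys_iff)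
      qed
      obtain g where g: "g \<in> dual_gens n a" "keys g = {ze i j + ze k l, ze i k + ze j l, ze i l + ze j k}"
        using quadratic_relation[of i n j k l a] quad by fastforce
      have "d i k \<le> d i j" "d i k \<le> d j k" "d j l \<le> d j k" "d j l \<le> d k l"
        using planar[of i j k] planar[of j k l] quad by auto
      moreover have "i \<noteq> k" "k \<noteq> l" "i \<noteq> l" using quad by auto
      then have "min (d i k) (d k l) \<le> d i l" using ultra[of i k l] quad by simp
      ultimately have d_le: "d i k + d j l \<le> d i j + d k l" "d i k + d j l \<le> d i l + d j k"
        by (auto simp: min_le_iff_disj)
      obtain p b q where pbq: "pos j = pos i + p" "pos k = pos i + p + b" "pos l = pos i + p + b + q"
        "0 < p" "0 < b" "0 < q"
      proof (rule that)
        show "pos j = pos i + (pos j - pos i)" "pos k = pos i + (pos j - pos i) + (pos k - pos j)"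
          "pos l = pos i + (pos j - pos i) + (pos k - pos j) + (pos l - pos k)"
          using quad by auto
      qed (use quad in auto)
      have \<mu>_eq: "\<mu> (zi i j) = f p" "\<mu> (zi k l) = f q" "\<mu> (zi i k) = f (p + b)" "\<mu> (zi j l) = f (b + q)"
        "\<mu> (zi i l) = f (p + b + q)" "\<mu> (zi j k) = f b"
        by (simp_all add: \<mu>_Z pbq add.assoc)
      have "\<mu> (zi i j) + \<mu> (zi k l) < \<mu> (zi i k) + \<mu> (zi j l)"
        "\<mu> (zi i l) + \<mu> (zi j k) < \<mu> (zi i k) + \<mu> (zi j l)"
        using f_cross[of p b q] pbq pos_le[of l] quad unfolding \<mu>_eq by auto
      then show ?thesis
        using g r d_le by (intro bexI[of _ g] bexI[of _ "ze i k + ze j l"] exI[of _ r])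
          (auto simp: weight_ze N_ze simp flip: of_nat_add)
    qed
  qed
qed


section \<open>Well-poisedness\<close>

theorem theorem1p4:
  fixes n :: nat and a :: "nat \<Rightarrow> nat"
  assumes "n \<ge> 1" and "\<And>i. i \<le> n \<Longrightarrow> a i > 0"
  shows "well_poised (XY_vars n) (I_ideal n a) \<and> well_poised (XZ_vars n) (I_dual_ideal n a)"
  using well_poised_I_ideal well_poised_I_dual_ideal by blast

end
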